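(* Let $A$ be a pro-$C^*$-algebra, $H$ a Hilbert space, and $\rho=[\rho_{ij}]_{i,j=1}^n$ a completely $n$-positive linear map from $A$ to $L(H)$ with Stinespring representation $(\Phi_\rho,H_\rho,V_{\rho,1},\dots,V_{\rho,n})$. Let $[0,\rho]=\{\theta\text{ completely }n\text{-positive from }A\text{ to }L(H):\theta\le\rho\}$ and $[0,I]_\rho=\{T\in\Phi_\rho(A)':0\le T\le I_{H_\rho}\}$. Then the map $T\mapsto\rho_T$ from $[0,I]_\rho$ to $[0,\rho]$ is an affine order isomorphism, i.e. it is a bijection of $[0,I]_\rho$ onto $[0,\rho]$ that preserves convex combinations and satisfies $T_1\le T_2\iff\rho_{T_1}\le\rho_{T_2}$.
   Context: A pro-$C^*$-algebra is a complete Hausdorff topological $*$-algebra over $\mathbb{C}$ whose topology is determined by its continuous $C^*$-seminorms. A representation of $A$ on a Hilbert space $K$ is a continuous $*$-morphism $A\to L(K)$. An $n\times n$ matrix $[\rho_{ij}]$ of continuous linear maps $A\to L(H)$ is completely $n$-positive if the map $M_n(A)\to M_n(L(H))$, $[a_{ij}]\mapsto[\rho_{ij}(a_{ij})]$, is completely positive; $\theta\le\rho$ means $\rho-\theta$ is completely $n$-positive. The Stinespring representation of $\rho$ consists of a representation $\Phi_\rho$ of $A$ on a Hilbert space $H_\rho$ and $V_{\rho,1},\dots,V_{\rho,n}\in L(H,H_\rho)$ with $\rho_{ij}(a)=V_{\rho,i}^*\Phi_\rho(a)V_{\rho,j}$ and $\{\Phi_\rho(a)V_{\rho,i}\xi\}$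 spanning a dense subspace of $H_\rho$ (exists, unique up to unitary equivalence). $\Phi_\rho(A)'$ is the commutant of $\Phi_\rho(A)$ in $L(H_\rho)$. For positive $T\in\Phi_\rho(A)'$, $\rho_T$ is the completely $n$-positive map $[a_{ij}]\mapsto[V_{\rho,i}^*T\Phi_\rho(a_{ij})V_{\rho,j}]_{i,j=1}^n$. *)

theory Defs
  imports "HOL-Analysis.Analysis"
begin

text \<open>A complex vector space is an abelian group with a complex scalar multiplication
  (Isabelle's module locale). Inner products are conjugate-linear in the first and
  linear in the second argument.\<close>

definition hnorm :: "('h \<Rightarrow> 'h \<Rightarrow> complex) \<Rightarrow> 'h \<Rightarrow> real" where
  "hnorm ip x = sqrt (Re (ip x x))"

definition hilbert_space ::
  "(complex \<Rightarrow> 'h::ab_group_add \<Rightarrow> 'h) \<Rightarrow> ('h \<Rightarrow> 'h \<Rightarrow> complex) \<Rightarrow> bool" where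
  "hilbert_space sc ip \<longleftrightarrow> module sc \<and>
     (\<forall>x y z. ip x (y + z) = ip x y + ip x z) \<and>
     (\<forall>c x y. ip x (sc c y) = c * ip x y) \<and>
     (\<forall>x y. ip y x = cnj (ip x y)) \<and>
     (\<forall>x. Im (ip x x) = 0 \<and> Re (ip x x) \<ge> 0) \<and>
     (\<forall>x. ip x x = 0 \<longrightarrow> x = 0) \<and>
     (\<forall>X::nat \<Rightarrow> 'h. (\<forall>e>0. \<exists>N. \<forall>m\<ge>N. \<forall>k\<ge>N. hnorm ip (X m - X k) < e)
        \<longrightarrow> (\<exists>l. (\<lambda>k. hnorm ip (X k - l)) \<longlonglongrightarrow> 0))"

definition bounded_op ::
  "(complex \<Rightarrow> 'h::ab_group_add \<Rightarrow> 'h) \<Rightarrow> ('h \<Rightarrow> 'h \<Rightarrow> complex) \<Rightarrow>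
   (complex \<Rightarrow> 'k::ab_group_add \<Rightarrow> 'k) \<Rightarrow> ('k \<Rightarrow> 'k \<Rightarrow> complex) \<Rightarrow> ('h \<Rightarrow> 'k) \<Rightarrow> bool" where
  "bounded_op scH ipH scK ipK T \<longleftrightarrow>
     (\<forall>x y. T (x + y) = T x + T y) \<and> (\<forall>c x. T (scH c x) = scK c (T x)) \<and>
     (\<exists>C. \<forall>x. hnorm ipK (T x) \<le> C * hnorm ipH x)"

definition adj :: "('h \<Rightarrow> 'h \<Rightarrow> complex) \<Rightarrow> ('k \<Rightarrow> 'k \<Rightarrow> complex) \<Rightarrow> ('h \<Rightarrow> 'k) \<Rightarrow> ('k \<Rightarrow> 'h)" where
  "adj ipH ipK T = (THE S. \<forall>x y. ipK (T x) y = ipH x (S y))"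

definition pos_op :: "('h \<Rightarrow> 'h \<Rightarrow> complex) \<Rightarrow> ('h \<Rightarrow> 'h) \<Rightarrow> bool" where
  "pos_op ip T \<longleftrightarrow> (\<forall>x. Im (ip x (T x)) = 0 \<and> Re (ip x (T x)) \<ge> 0)"

definition op_le :: "('h::ab_group_add \<Rightarrow> 'h \<Rightarrow> complex) \<Rightarrow> ('h \<Rightarrow> 'h) \<Rightarrow> ('h \<Rightarrow> 'h) \<Rightarrow> bool" where
  "op_le ip T1 T2 \<longleftrightarrow> pos_op ip (\<lambda>x. T2 x - T1 x)"

definition star_algebra :: "(complex \<Rightarrow> 'a::ring \<Rightarrow> 'a) \<Rightarrow> ('a \<Rightarrow> 'a) \<Rightarrow> bool" where
  "star_algebra sc st \<longleftrightarrow> module sc \<and>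
     (\<forall>c x y. sc c (x * y) = sc c x * y \<and> sc c (x * y) = x * sc c y) \<and>
     (\<forall>x y. st (x + y) = st x + st y) \<and> (\<forall>c x. st (sc c x) = sc (cnj c) (st x)) \<and>
     (\<forall>x y. st (x * y) = st y * st x) \<and> (\<forall>x. st (st x) = x)"

definition C_star_seminorm :: "(complex \<Rightarrow> 'a::ring \<Rightarrow> 'a) \<Rightarrow> ('a \<Rightarrow> 'a) \<Rightarrow> ('a \<Rightarrow> real) \<Rightarrow> bool" where
  "C_star_seminorm sc st p \<longleftrightarrow> (\<forall>x. p x \<ge> 0) \<and> (\<forall>x y. p (x + y) \<le> p x + p y) \<and>
     (\<forall>c x. p (sc c x) = cmod c * p x) \<and> (\<forall>x y. p (x * y) \<le> p x * p y) \<and>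
     (\<forall>x. p (st x * x) = (p x)\<^sup>2)"

definition cont_C_star_seminorms ::
  "(complex \<Rightarrow> 'a::ring \<Rightarrow> 'a) \<Rightarrow> ('a \<Rightarrow> 'a) \<Rightarrow> 'a topology \<Rightarrow> ('a \<Rightarrow> real) set" where
  "cont_C_star_seminorms sc st \<tau> = {p. C_star_seminorm sc st p \<and> continuous_map \<tau> euclideanreal p}"

definition pro_C_star_algebra ::
  "(complex \<Rightarrow> 'a::ring \<Rightarrow> 'a) \<Rightarrow> ('a \<Rightarrow> 'a) \<Rightarrow> 'a topology \<Rightarrow> bool" where
  "pro_C_star_algebra sc st \<tau> \<longleftrightarrow> star_algebra sc st \<and> topspace \<tau> = UNIV \<and>
     continuous_map (prod_topology \<tau> \<tau>) \<tau> (\<lambda>(x, y). x + y) \<and>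
     continuous_map (prod_topology \<tau> \<tau>) \<tau> (\<lambda>(x, y). x * y) \<and>
     continuous_map (prod_topology euclidean \<tau>) \<tau> (\<lambda>(c, x). sc c x) \<and>
     continuous_map \<tau> \<tau> st \<and>
     (\<forall>U. openin \<tau> U \<longleftrightarrow>
        (\<forall>x\<in>U. \<exists>F e. finite F \<and> F \<subseteq> cont_C_star_seminorms sc st \<tau> \<and> e > 0 \<and>
                     {y. \<forall>p\<in>F. p (y - x) < e} \<subseteq> U)) \<and>
     Hausdorff_space \<tau> \<and>
     (\<forall>F::'a filter. F \<noteq> bot \<and>
        (\<forall>p\<in>cont_C_star_seminorms sc st \<tau>. \<forall>e>0. eventually (\<lambda>(x, y). p (x - y) < e) (F \<times>\<^sub>F F))
        \<longrightarrow> (\<exists>x. limitin \<tau> id x F))"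

definition op_continuous ::
  "'a topology \<Rightarrow> ('h \<Rightarrow> 'h \<Rightarrow> complex) \<Rightarrow> ('k::ab_group_add \<Rightarrow> 'k \<Rightarrow> complex) \<Rightarrow> ('a \<Rightarrow> 'h \<Rightarrow> 'k) \<Rightarrow> bool" where
  "op_continuous \<tau> ipH ipK f \<longleftrightarrow>
     (\<forall>a e. e > 0 \<longrightarrow> (\<exists>U. openin \<tau> U \<and> a \<in> U \<and>
        (\<forall>b\<in>U. \<forall>x. hnorm ipK (f b x - f a x) \<le> e * hnorm ipH x)))"

definition cont_linear_map ::
  "(complex \<Rightarrow> 'a::ring \<Rightarrow> 'a) \<Rightarrow> 'a topology \<Rightarrow> (complex \<Rightarrow> 'h::ab_group_add \<Rightarrow> 'h) \<Rightarrow>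
   ('h \<Rightarrow> 'h \<Rightarrow> complex) \<Rightarrow> ('a \<Rightarrow> 'h \<Rightarrow> 'h) \<Rightarrow> bool" where
  "cont_linear_map sc \<tau> scH ipH f \<longleftrightarrow> (\<forall>a. bounded_op scH ipH scH ipH (f a)) \<and>
     (\<forall>a b. f (a + b) = (\<lambda>x. f a x + f b x)) \<and> (\<forall>c a. f (sc c a) = (\<lambda>x. scH c (f a x))) \<and>
     op_continuous \<tau> ipH ipH f"

definition representation ::
  "(complex \<Rightarrow> 'a::ring \<Rightarrow> 'a) \<Rightarrow> ('a \<Rightarrow> 'a) \<Rightarrow> 'a topology \<Rightarrow>
   (complex \<Rightarrow> 'k::ab_group_add \<Rightarrow> 'k) \<Rightarrow> ('k \<Rightarrow> 'k \<Rightarrow> complex) \<Rightarrow> ('a \<Rightarrow> 'k \<Rightarrow> 'k) \<Rightarrow> bool" where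
  "representation sc st \<tau> scK ipK \<Phi> \<longleftrightarrow> cont_linear_map sc \<tau> scK ipK \<Phi> \<and>
     (\<forall>a b. \<Phi> (a * b) = \<Phi> a \<circ> \<Phi> b) \<and> (\<forall>a. \<Phi> (st a) = adj ipK ipK (\<Phi> a))"

text \<open>rho = [rho i j] (i, j < n) is completely n-positive: each rho i j is continuous
  linear and [a_ij] \<mapsto> [rho_ij(a_ij)] is completely positive M_n(A) \<rightarrow> M_n(L(H)).
  M_m(M_n(A)) is identified with matrices indexed by ({..<m} \<times> {..<n})^2; its positive
  elements are those of the form B* B; positivity in M_m(M_n(L(H))) is positivity as an
  operator on H^(mn).\<close>
definition cn_positive ::
  "(complex \<Rightarrow> 'a::ring \<Rightarrow> 'a) \<Rightarrow> ('a \<Rightarrow> 'a) \<Rightarrow> 'a topology \<Rightarrow>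
   (complex \<Rightarrow> 'h::ab_group_add \<Rightarrow> 'h) \<Rightarrow> ('h \<Rightarrow> 'h \<Rightarrow> complex) \<Rightarrow> nat \<Rightarrow>
   (nat \<Rightarrow> nat \<Rightarrow> 'a \<Rightarrow> 'h \<Rightarrow> 'h) \<Rightarrow> bool" where
  "cn_positive sc st \<tau> scH ipH n \<rho> \<longleftrightarrow>
     (\<forall>i<n. \<forall>j<n. cont_linear_map sc \<tau> scH ipH (\<rho> i j)) \<and>
     (\<forall>(m::nat) (B :: nat \<times> nat \<Rightarrow> nat \<times> nat \<Rightarrow> 'a) (\<xi> :: nat \<times> nat \<Rightarrow> 'h).
        let I = {..<m} \<times> {..<n};
            X = (\<lambda>(k, i) (l, j). \<Sum>r\<in>I. st (B r (k, i)) * B r (l, j));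
            s = (\<Sum>(k, i)\<in>I. \<Sum>(l, j)\<in>I. ipH (\<xi> (k, i)) (\<rho> i j (X (k, i) (l, j)) (\<xi> (l, j))))
        in Im s = 0 \<and> Re s \<ge> 0)"

definition cn_le ::
  "(complex \<Rightarrow> 'a::ring \<Rightarrow> 'a) \<Rightarrow> ('a \<Rightarrow> 'a) \<Rightarrow> 'a topology \<Rightarrow>
   (complex \<Rightarrow> 'h::ab_group_add \<Rightarrow> 'h) \<Rightarrow> ('h \<Rightarrow> 'h \<Rightarrow> complex) \<Rightarrow> nat \<Rightarrow>
   (nat \<Rightarrow> nat \<Rightarrow> 'a \<Rightarrow> 'h \<Rightarrow> 'h) \<Rightarrow> (nat \<Rightarrow> nat \<Rightarrow> 'a \<Rightarrow> 'h \<Rightarrow> 'h) \<Rightarrow> bool" where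
  "cn_le sc st \<tau> scH ipH n \<theta> \<rho> \<longleftrightarrow>
     cn_positive sc st \<tau> scH ipH n (\<lambda>i j a x. \<rho> i j a x - \<theta> i j a x)"

text \<open>n \<times> n matrices of maps are represented extensionally: entries outside i, j < n
  are undefined.\<close>
definition nmat_ext :: "nat \<Rightarrow> (nat \<Rightarrow> nat \<Rightarrow> 'x) \<Rightarrow> bool" where
  "nmat_ext n \<theta> \<longleftrightarrow> (\<forall>i j. \<not> (i < n \<and> j < n) \<longrightarrow> \<theta> i j = undefined)"

definition cp_interval ::
  "(complex \<Rightarrow> 'a::ring \<Rightarrow> 'a) \<Rightarrow> ('a \<Rightarrow> 'a) \<Rightarrow> 'a topology \<Rightarrow>
   (complex \<Rightarrow> 'h::ab_group_add \<Rightarrow> 'h) \<Rightarrow> ('h \<Rightarrow> 'h \<Rightarrow> complex) \<Rightarrow> nat \<Rightarrow>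
   (nat \<Rightarrow> nat \<Rightarrow> 'a \<Rightarrow> 'h \<Rightarrow> 'h) \<Rightarrow> (nat \<Rightarrow> nat \<Rightarrow> 'a \<Rightarrow> 'h \<Rightarrow> 'h) set" where
  "cp_interval sc st \<tau> scH ipH n \<rho> =
     {\<theta>. nmat_ext n \<theta> \<and> cn_positive sc st \<tau> scH ipH n \<theta> \<and> cn_le sc st \<tau> scH ipH n \<theta> \<rho>}"

definition stinespring_rep ::
  "(complex \<Rightarrow> 'a::ring \<Rightarrow> 'a) \<Rightarrow> ('a \<Rightarrow> 'a) \<Rightarrow> 'a topology \<Rightarrow>
   (complex \<Rightarrow> 'h::ab_group_add \<Rightarrow> 'h) \<Rightarrow> ('h \<Rightarrow> 'h \<Rightarrow> complex) \<Rightarrow> nat \<Rightarrow>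
   (nat \<Rightarrow> nat \<Rightarrow> 'a \<Rightarrow> 'h \<Rightarrow> 'h) \<Rightarrow>
   (complex \<Rightarrow> 'k::ab_group_add \<Rightarrow> 'k) \<Rightarrow> ('k \<Rightarrow> 'k \<Rightarrow> complex) \<Rightarrow>
   ('a \<Rightarrow> 'k \<Rightarrow> 'k) \<Rightarrow> (nat \<Rightarrow> 'h \<Rightarrow> 'k) \<Rightarrow> bool" where
  "stinespring_rep sc st \<tau> scH ipH n \<rho> scK ipK \<Phi> V \<longleftrightarrow>
     hilbert_space scK ipK \<and> representation sc st \<tau> scK ipK \<Phi> \<and>
     (\<forall>i<n. bounded_op scH ipH scK ipK (V i)) \<and>
     (\<forall>i<n. \<forall>j<n. \<forall>a. \<rho> i j a = adj ipH ipK (V i) \<circ> \<Phi> a \<circ> V j) \<and>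
     (\<forall>y e. e > 0 \<longrightarrow> (\<exists>z\<in>module.span scK {\<Phi> a (V i \<xi>) | a i \<xi>. i < n}. hnorm ipK (y - z) < e))"

definition commutant ::
  "(complex \<Rightarrow> 'k::ab_group_add \<Rightarrow> 'k) \<Rightarrow> ('k \<Rightarrow> 'k \<Rightarrow> complex) \<Rightarrow> ('a \<Rightarrow> 'k \<Rightarrow> 'k) \<Rightarrow> ('k \<Rightarrow> 'k) set" where
  "commutant scK ipK \<Phi> = {T. bounded_op scK ipK scK ipK T \<and> (\<forall>a. T \<circ> \<Phi> a = \<Phi> a \<circ> T)}"

definition unit_interval_comm ::
  "(complex \<Rightarrow> 'k::ab_group_add \<Rightarrow> 'k) \<Rightarrow> ('k \<Rightarrow> 'k \<Rightarrow> complex) \<Rightarrow> ('a \<Rightarrow> 'k \<Rightarrow> 'k) \<Rightarrow> ('k \<Rightarrow> 'k) set" where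
  "unit_interval_comm scK ipK \<Phi> =
     {T \<in> commutant scK ipK \<Phi>. op_le ipK (\<lambda>x. 0) T \<and> op_le ipK T id}"

definition rho_T ::
  "nat \<Rightarrow> ('h \<Rightarrow> 'h \<Rightarrow> complex) \<Rightarrow> ('k \<Rightarrow> 'k \<Rightarrow> complex) \<Rightarrow> ('a \<Rightarrow> 'k \<Rightarrow> 'k) \<Rightarrow>
   (nat \<Rightarrow> 'h \<Rightarrow> 'k) \<Rightarrow> ('k \<Rightarrow> 'k) \<Rightarrow> (nat \<Rightarrow> nat \<Rightarrow> 'a \<Rightarrow> 'h \<Rightarrow> 'h)" where
  "rho_T n ipH ipK \<Phi> V T =
     (\<lambda>i j. if i < n \<and> j < n then (\<lambda>a. adj ipH ipK (V i) \<circ> T \<circ> \<Phi> a \<circ> V j) else undefined)"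

end

(* Under the Stinespring representation, elementary tensors e_i (x) a (x) xi in C^n (x) A (x) H go to
   Phi(a) V_i xi, and rho becomes the inner product of K. A completely n-positive theta <= rho is a
   second positive form on these tensors dominated by the first, so by Cauchy-Schwarz and Riesz
   it is <x, T y> for a unique T with 0 <= T <= I, and T commutes with Phi(A) because both forms
   satisfy <b a, a'> = <a, b* a'>. This yields theta_ij = V_i* T Phi(.) V_j on products in A;
   as A need not have a unit, one also needs that products are total in A. For D in the
   commutant, complete n-positivity of V_i* D Phi(.) V_j is positivity of the form of D on
   a dense subspace, i.e. D >= 0; this gives the order statement and, from it, injectivity. *)

theory Submission
  imports Defs
begin

section \<open>Hilbert spaces\<close>

text \<open>Two obstacles shape the argument. The form of theta lives on lists of tensors, and
  different lists may give the same vector of K. No quotient or completion is formed: a functional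
  enters Riesz as the graph of its pairs (vector, value), and the bound |value| <= C |vector|
  already makes this graph single-valued. Riesz is used twice, first to turn the left argument of
  the form into a map y from lists to K, then on the functionals sending M to <x, y M> for every x
  in K. So T is defined on all of K at once, without extension by continuity.

  The Gram form sees theta only at elements st a * b. The usual way from there to all of A is an
  approximate unit or a square root. Here powers of 1 + i s h in the unitisation do the work: modulo
  products only the linear term of such a power survives, and the C*-identity bounds the power. With
  s of order 1/N and exponent N^2, the linear term grows like N while the seminorms stay below a
  fixed constant.\<close>

locale hilbert =
  fixes sc :: "complex \<Rightarrow> 'h::ab_group_add \<Rightarrow> 'h" and ip :: "'h \<Rightarrow> 'h \<Rightarrow> complex"
  assumes hilbert: "hilbert_space sc ip"
begin

sublocale module sc
  using hilbert by (simp add: hilbert_space_def)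

lemmas ip_axioms = hilbert[unfolded hilbert_space_def, THEN conjunct2]

lemmas ip_add_right = ip_axioms[THEN conjunct1, rule_format]
  and ip_scale_right = ip_axioms[THEN conjunct2, THEN conjunct1, rule_format]
  and ip_cnj = ip_axioms[THEN conjunct2, THEN conjunct2, THEN conjunct1, rule_format]
  and ip_self_Im = ip_axioms[THEN conjunct2, THEN conjunct2, THEN conjunct2, THEN conjunct1,
    rule_format, THEN conjunct1]
  and ip_self_Re = ip_axioms[THEN conjunct2, THEN conjunct2, THEN conjunct2, THEN conjunct1,
    rule_format, THEN conjunct2]
  and ip_self_zero = ip_axioms[THEN conjunct2, THEN conjunct2, THEN conjunct2, THEN conjunct2,
    THEN conjunct1, rule_format]
  and complete_axiom = ip_axioms[THEN conjunct2, THEN conjunct2, THEN conjunct2, THEN conjunct2,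
    THEN conjunct2, rule_format]

lemma ip_add_left: "ip (x + y) z = ip x z + ip y z"
  using ip_cnj[of "x + y" z] ip_cnj[of x z] ip_cnj[of y z] by (simp add: ip_add_right)

lemma ip_scale_left: "ip (sc c x) y = cnj c * ip x y"
  using ip_cnj[of "sc c x" y] ip_cnj[of x y] by (simp add: ip_scale_right)

lemma ip_zero_right [simp]: "ip x 0 = 0"
  using ip_add_right[of x 0 0] by simp

lemma ip_zero_left [simp]: "ip 0 x = 0"
  using ip_add_left[of 0 0 x] by simp

lemma ip_minus_right: "ip x (- y) = - ip x y"
  using ip_add_right[of x y "- y"] by (simp add: eq_neg_iff_add_eq_0 add.commute)

lemma ip_minus_left: "ip (- x) y = - ip x y"
  using ip_add_left[of x "- x" y] by (simp add: eq_neg_iff_add_eq_0 add.commute)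

lemma ip_diff_right: "ip x (y - z) = ip x y - ip x z"
  using ip_add_right[of x y "- z"] by (simp add: ip_minus_right)

lemma ip_diff_left: "ip (x - y) z = ip x z - ip y z"
  using ip_add_left[of x "- y" z] by (simp add: ip_minus_left)

lemma ip_sum_right: "ip x (\<Sum>i\<in>A. f i) = (\<Sum>i\<in>A. ip x (f i))"
  by (induction A rule: infinite_finite_induct) (auto simp: ip_add_right)

lemma ip_sum_left: "ip (\<Sum>i\<in>A. f i) x = (\<Sum>i\<in>A. ip (f i) x)"
  by (induction A rule: infinite_finite_induct) (auto simp: ip_add_left)

lemmas ip_simps = ip_add_left ip_add_right ip_diff_left ip_diff_right ip_scale_left
  ip_scale_right ip_minus_left ip_minus_right

lemma ip_ext:
  assumes "\<And>y. ip x y = ip x' y" shows "x = x'"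
  using ip_self_zero[of "x - x'"] assms by (simp add: ip_diff_left)

abbreviation nrm :: "'h \<Rightarrow> real" where "nrm \<equiv> hnorm ip"

lemma nrm_ge0 [simp]: "nrm x \<ge> 0"
  by (simp add: hnorm_def ip_self_Re)

lemma nrm_sq: "(nrm x)\<^sup>2 = Re (ip x x)"
  by (simp add: hnorm_def ip_self_Re)

lemma ip_self: "ip x x = of_real ((nrm x)\<^sup>2)"
  by (simp add: complex_eq_iff nrm_sq ip_self_Im)

lemma nrm_eq_0 [simp]: "nrm x = 0 \<longleftrightarrow> x = 0"
proof
  assume "nrm x = 0"
  thus "x = 0" by (intro ip_self_zero) (simp add: ip_self)
qed (simp add: hnorm_def)

lemma nrm_scale: "nrm (sc c x) = cmod c * nrm x"
proof -
  have "(nrm (sc c x))\<^sup>2 = (cmod c * nrm x)\<^sup>2"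
    unfolding nrm_sq power_mult_distrib cmod_power2
    by (simp add: ip_scale_left ip_scale_right ip_self_Im power2_eq_square algebra_simps)
  thus ?thesis
    by (simp add: power2_eq_iff_nonneg)
qed

lemma nrm_uminus: "nrm (- x) = nrm x"
  by (simp add: hnorm_def ip_minus_left ip_minus_right)

lemma nrm_minus_commute: "nrm (x - y) = nrm (y - x)"
  using nrm_uminus[of "x - y"] by simp

end

text \<open>Kept apart from \<open>hilbert\<close> because it serves two forms, the inner product
  and the possibly degenerate Gram form of a completely positive map. The hypothesis is the value of
  the form at x + c y; for C > 0 the optimal choice is c = - t \<open>cnj B\<close> with t =
  1/C.\<close>

lemma quadratic_form_discriminant:
  fixes A C :: real and B :: complex
  assumes nonneg: "\<And>c. A + 2 * Re (c * B) + (cmod c)\<^sup>2 * C \<ge> 0" and C: "C \<ge> 0"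
  shows "(cmod B)\<^sup>2 \<le> A * C"
proof -
  have *: "A - 2 * t * (cmod B)\<^sup>2 + t\<^sup>2 * (cmod B)\<^sup>2 * C \<ge> 0" for t :: real
  proof -
    have "cnj B * B = of_real ((cmod B)\<^sup>2)"
      by (metis complex_norm_square mult.commute of_real_power)
    thus ?thesis
      using nonneg[of "of_real (-t) * cnj B"]
      by (simp add: norm_mult power_mult_distrib mult.assoc)
  qed
  show ?thesis
  proof (cases "C = 0")
    case True
    have "cmod B = 0"
    proof (rule ccontr)
      assume "cmod B \<noteq> 0"
      \<comment> \<open>With this t the left-hand side A - 2 t |B|^2 becomes -1.\<close>
      thus False using *[of "(A + 1) / (2 * (cmod B)\<^sup>2)"] True by (simp add: field_simps)
    qed
    thus ?thesis using True by simp
  next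
    case False
    hence "C > 0" using C by simp
    have "A - 2 * (cmod B)\<^sup>2 / C + (cmod B)\<^sup>2 / C \<ge> 0"
      using *[of "1/C"] \<open>C > 0\<close> by (simp add: power2_eq_square field_simps)
    thus ?thesis using \<open>C > 0\<close> by (simp add: field_simps)
  qed
qed

context hilbert
begin

lemma Cauchy_Schwarz: "cmod (ip x y) \<le> nrm x * nrm y"
proof -
  have "(cmod (ip x y))\<^sup>2 \<le> (nrm x)\<^sup>2 * (nrm y)\<^sup>2"
  proof (rule quadratic_form_discriminant)
    fix c
    have "0 \<le> Re (ip (x + sc c y) (x + sc c y))" by (rule ip_self_Re)
    also have "ip (x + sc c y) (x + sc c y)
      = of_real ((nrm x)\<^sup>2) + (c * ip x y + cnj (c * ip x y)) + of_real ((cmod c)\<^sup>2 * (nrm y)\<^sup>2)"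
      using complex_norm_square[of c]
      by (simp add: ip_add_left ip_add_right ip_scale_left ip_scale_right)
        (simp add: ip_self ip_cnj[of y x] algebra_simps)
    finally show "0 \<le> (nrm x)\<^sup>2 + 2 * Re (c * ip x y) + (cmod c)\<^sup>2 * (nrm y)\<^sup>2" by simp
  qed simp
  thus ?thesis
    by (metis nrm_ge0 mult_nonneg_nonneg power2_le_imp_le power_mult_distrib)
qed

lemma nrm_triangle: "nrm (x + y) \<le> nrm x + nrm y"
proof -
  have "(nrm (x + y))\<^sup>2 = (nrm x)\<^sup>2 + 2 * Re (ip x y) + (nrm y)\<^sup>2"
    using ip_cnj[of y x] unfolding nrm_sq by (simp add: ip_simps)
  also have "Re (ip x y) \<le> nrm x * nrm y"
    using Cauchy_Schwarz[of x y] complex_Re_le_cmod[of "ip x y"] by linarith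
  finally have "(nrm (x + y))\<^sup>2 \<le> (nrm x + nrm y)\<^sup>2"
    by (simp add: power2_sum)
  thus ?thesis by (rule power2_le_imp_le) simp
qed

lemma nrm_triangle_diff: "nrm (x - y) \<le> nrm x + nrm y"
  using nrm_triangle[of x "- y"] by (simp add: nrm_uminus)

lemma complete:
  assumes "\<And>e. e > 0 \<Longrightarrow> \<exists>N. \<forall>m\<ge>N. \<forall>k\<ge>N. nrm (X m - X k) < e"
  obtains l where "(\<lambda>k. nrm (X k - l)) \<longlonglongrightarrow> 0"
  using complete_axiom[of X] assms that by blast

lemma tendsto_ip:
  assumes "(\<lambda>k. nrm (X k - l)) \<longlonglongrightarrow> 0"
  shows "(\<lambda>k. ip (X k) y) \<longlonglongrightarrow> ip l y"
proof (rule LIM_zero_cancel, rule tendsto_norm_zero_cancel)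
  have "(\<lambda>k. nrm (X k - l) * nrm y) \<longlonglongrightarrow> 0"
    using tendsto_mult_right[OF assms, of "nrm y"] by simp
  thus "(\<lambda>k. norm (ip (X k) y - ip l y)) \<longlonglongrightarrow> 0"
    by (rule Lim_null_comparison[rotated])
      (use Cauchy_Schwarz in \<open>auto simp flip: ip_diff_left\<close>)
qed

text \<open>The functional is given by its graph G, a subspace of the product of the space with the
  scalars. The minimiser of the functional |z|^2 - 2 Re c over G represents it; its
  existence needs neither closedness nor density of the domain.\<close>

lemma Riesz_on_subspace:
  fixes G :: "('h \<times> complex) set"
  assumes zero: "(0, 0) \<in> G"
    and add: "\<And>z c w d. (z, c) \<in> G \<Longrightarrow> (w, d) \<in> G \<Longrightarrow> (z + w, c + d) \<in> G"
    and scale: "\<And>z c a. (z, c) \<in> G \<Longrightarrow> (sc a z, a * c) \<in> G"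
    and bound: "\<And>z c. (z, c) \<in> G \<Longrightarrow> cmod c \<le> C * nrm z"
  shows "\<exists>y. \<forall>(z, c)\<in>G. c = ip y z"
proof -
  define J where "J = (\<lambda>(z, c). (nrm z)\<^sup>2 - 2 * Re c)"
  define I where "I = Inf (J ` G)"
  \<comment> \<open>Completing the square: |z|^2 - 2 C |z| = (|z| - C)^2 - C^2.\<close>
  have lower: "J u \<ge> - C\<^sup>2" if u: "u \<in> G" for u
  proof -
    obtain z c where [simp]: "u = (z, c)" by fastforce
    have "Re c \<le> C * nrm z"
      using bound[of z c] u complex_Re_le_cmod[of c] by simp
    moreover have "(nrm z - C)\<^sup>2 \<ge> 0" by simp
    ultimately show ?thesis by (simp add: J_def power2_diff) (simp add: algebra_simps)
  qed
  hence bdd: "bdd_below (J ` G)" by (meson bdd_belowI2)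
  have I_le: "I \<le> J u" if "u \<in> G" for u
    unfolding I_def using bdd that by (simp add: cINF_lower)
  have "\<exists>u\<in>G. J u < I + inverse (real (Suc k))" for k
    using cInf_lessD[of "J ` G" "I + inverse (real (Suc k))"] zero
    unfolding I_def by fastforce
  then obtain U where UG: "\<And>k. U k \<in> G" and UI: "\<And>k. J (U k) < I + inverse (real (Suc k))"
    by metis
  define Z where "Z = fst \<circ> U"
  define c where "c = snd \<circ> U"
  have ZG: "(Z k, c k) \<in> G" for k
    using UG[of k] by (simp add: Z_def c_def)
  have ZI: "(nrm (Z k))\<^sup>2 - 2 * Re (c k) < I + inverse (real (Suc k))" for k
    using UI[of k] by (simp add: Z_def c_def J_def case_prod_beta)
  \<comment> \<open>The midpoint of two members of G lies in G, so J is at least I there; the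
    parallelogram law turns this into closeness of two near-minimisers.\<close>
  have close: "(nrm (Z m - Z k))\<^sup>2 \<le> 2 * inverse (real (Suc m)) + 2 * inverse (real (Suc k))" for m k
  proof -
    have "(sc (1/2) (Z m + Z k), 1/2 * (c m + c k)) \<in> G"
      by (intro scale add ZG)
    hence "I \<le> (nrm (sc (1/2) (Z m + Z k)))\<^sup>2 - 2 * Re (1/2 * (c m + c k))"
      using I_le by (fastforce simp: J_def)
    hence "4 * I \<le> (nrm (Z m + Z k))\<^sup>2 - 4 * Re (c m) - 4 * Re (c k)"
      unfolding nrm_scale power_mult_distrib by (simp add: power2_eq_square) argo
    moreover have "(nrm (Z m + Z k))\<^sup>2 + (nrm (Z m - Z k))\<^sup>2 = 2 * (nrm (Z m))\<^sup>2 + 2 * (nrm (Z k))\<^sup>2"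
      unfolding nrm_sq by (simp add: ip_simps)
    ultimately show ?thesis using ZI[of m] ZI[of k] by argo
  qed
  obtain y where y: "(\<lambda>k. nrm (Z k - y)) \<longlonglongrightarrow> 0"
  proof (rule complete)
    fix e :: real assume e: "e > 0"
    obtain N where N: "inverse (real (Suc N)) < e\<^sup>2 / 4"
      using reals_Archimedean[of "e\<^sup>2 / 4"] e by auto
    have "nrm (Z m - Z k) < e" if "m \<ge> N" "k \<ge> N" for m k
    proof -
      have "inverse (real (Suc m)) \<le> inverse (real (Suc N))" "inverse (real (Suc k)) \<le> inverse (real (Suc N))"
        using that by (simp_all add: field_simps)
      hence "(nrm (Z m - Z k))\<^sup>2 < e\<^sup>2" using close[of m k] N by argo
      thus ?thesis using e by (meson power2_less_imp_less less_imp_le)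
    qed
    thus "\<exists>N. \<forall>m\<ge>N. \<forall>k\<ge>N. nrm (Z m - Z k) < e" by blast
  qed
  \<comment> \<open>First variation of J: moving from U k by t (w, d) cannot push J below I. The
    scalars c k cancel, so only the limit of Z k is needed.\<close>
  have Re_le: "2 * Re (d - ip y w) \<le> t * (nrm w)\<^sup>2" if wd: "(w, d) \<in> G" and t: "t > 0" for w d t
  proof -
    have step: "2 * t * Re (d - ip (Z k) w) \<le> t\<^sup>2 * (nrm w)\<^sup>2 + inverse (real (Suc k))" for k
    proof -
      have "(Z k + sc (of_real t) w, c k + of_real t * d) \<in> G"
        by (intro add scale ZG wd)
      hence "I \<le> (nrm (Z k + sc (of_real t) w))\<^sup>2 - 2 * Re (c k + of_real t * d)"
        using I_le by (fastforce simp: J_def)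
      also have "(nrm (Z k + sc (of_real t) w))\<^sup>2 = (nrm (Z k))\<^sup>2 + 2 * t * Re (ip (Z k) w) + t\<^sup>2 * (nrm w)\<^sup>2"
        using ip_cnj[of w "Z k"] unfolding nrm_sq by (simp add: ip_simps power2_eq_square algebra_simps)
      finally show ?thesis using ZI[of k] by (simp add: algebra_simps)
    qed
    have "(\<lambda>k. 2 * t * Re (d - ip (Z k) w)) \<longlonglongrightarrow> 2 * t * Re (d - ip y w)"
      by (intro tendsto_intros tendsto_ip y)
    moreover have "(\<lambda>k. t\<^sup>2 * (nrm w)\<^sup>2 + inverse (real (Suc k))) \<longlonglongrightarrow> t\<^sup>2 * (nrm w)\<^sup>2 + 0"
      by (intro tendsto_intros LIMSEQ_inverse_real_of_nat)
    ultimately have "2 * t * Re (d - ip y w) \<le> t\<^sup>2 * (nrm w)\<^sup>2 + 0"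
      by (rule LIMSEQ_le) (use step in auto)
    thus ?thesis using t by (simp add: power2_eq_square mult.assoc mult.left_commute[of 2 t])
  qed
  have Re_le0: "Re (d - ip y w) \<le> 0" if wd: "(w, d) \<in> G" for w d
  proof (rule ccontr)
    assume *: "\<not> Re (d - ip y w) \<le> 0"
    define r where "r = Re (d - ip y w)"
    have "r > 0" using * by (simp add: r_def)
    \<comment> \<open>This t keeps t |w|^2 at most r, against the lower bound 2 r, and is also
      defined for w = 0.\<close>
    have "2 * r \<le> r / ((nrm w)\<^sup>2 + 1) * (nrm w)\<^sup>2"
      unfolding r_def by (rule Re_le[OF wd]) (use * in \<open>simp add: add_nonneg_pos\<close>)
    also have "\<dots> = r * ((nrm w)\<^sup>2 / ((nrm w)\<^sup>2 + 1))" by simp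
    also have "\<dots> \<le> r * 1"
      using \<open>r > 0\<close> by (intro mult_left_mono) (auto simp: divide_le_eq_1 add_nonneg_pos)
    finally show False using \<open>r > 0\<close> by simp
  qed
  have "d = ip y w" if wd: "(w, d) \<in> G" for w d
  proof -
    \<comment> \<open>G admits complex multiples, so the one-sided bound may be rotated by 1, -1, i
      and -i; this annihilates both the real and the imaginary part.\<close>
    have "Re (a * (d - ip y w)) \<le> 0" for a
      using Re_le0[OF scale[OF wd, of a]] by (simp add: ip_scale_right algebra_simps)
    from this[of 1] this[of "-1"] this[of "\<i>"] this[of "-\<i>"] show ?thesis
      by (simp add: complex_eq_iff)
  qed
  thus ?thesis by blast
qed

end

section \<open>Bounded operators and adjoints\<close>

lemma bounded_opD:
  assumes "bounded_op scH ipH scK ipK T"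
  shows "T (x + y) = T x + T y" "T (scH c x) = scK c (T x)"
  using assms by (auto simp: bounded_op_def)

text \<open>\<open>bounded_op\<close> leaves the sign of C open; composing estimates requires a
  non-negative constant.\<close>

lemma bounded_op_bound:
  assumes "bounded_op scH ipH scK ipK T" "hilbert scH ipH"
  obtains C where "C \<ge> 0" "\<And>x. hnorm ipK (T x) \<le> C * hnorm ipH x"
proof -
  obtain C where C: "\<And>x. hnorm ipK (T x) \<le> C * hnorm ipH x"
    using assms by (auto simp: bounded_op_def)
  have "hnorm ipK (T x) \<le> max C 0 * hnorm ipH x" for x
    using C[of x] mult_right_mono[of C "max C 0" "hnorm ipH x"] hilbert.nrm_ge0[OF assms(2), of x]
    by linarith
  thus ?thesis using that[of "max C 0"] by auto
qed

lemma bounded_op_zero: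
  assumes "bounded_op scH ipH scK ipK T" shows "T 0 = 0"
  using bounded_opD(1)[OF assms, of 0 0] by simp

lemma bounded_op_diff:
  assumes "bounded_op scH ipH scK ipK T" shows "T (x - y) = T x - T y"
  using bounded_opD(1)[OF assms, of "x - y" y] by simp

lemma bounded_op_sum:
  assumes "bounded_op scH ipH scK ipK T" shows "T (\<Sum>i\<in>A. f i) = (\<Sum>i\<in>A. T (f i))"
  by (induction A rule: infinite_finite_induct)
    (auto simp: bounded_op_zero[OF assms] bounded_opD[OF assms])

text \<open>\<open>adj\<close> is a definite description, so it has this property only once an
  adjoint is known to exist and to be unique. Existence is Riesz applied to the functionals sending
  x to <y, T x>.\<close>

lemma adj_ip:
  assumes H: "hilbert scH ipH" and K: "hilbert scK ipK" and T: "bounded_op scH ipH scK ipK T"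
  shows "ipK (T x) y = ipH x (adj ipH ipK T y)"
proof -
  interpret H: hilbert scH ipH by (rule H)
  interpret K: hilbert scK ipK by (rule K)
  obtain C where C: "C \<ge> 0" "\<And>x. hnorm ipK (T x) \<le> C * hnorm ipH x"
    using bounded_op_bound[OF T H] by blast
  have "\<exists>s. \<forall>x. ipK y (T x) = ipH s x" for y
  proof -
    have "\<exists>s. \<forall>(z, c)\<in>{(x, ipK y (T x)) | x. True}. c = ipH s z"
    proof (rule H.Riesz_on_subspace)
      show "(0, 0) \<in> {(x, ipK y (T x)) | x. True}"
        by (simp add: bounded_op_zero[OF T])
    next
      fix z c assume "(z, c) \<in> {(x, ipK y (T x)) | x. True}"
      hence "cmod c \<le> hnorm ipK y * hnorm ipK (T z)"
        using K.Cauchy_Schwarz by auto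
      also have "\<dots> \<le> hnorm ipK y * (C * hnorm ipH z)"
        by (intro mult_left_mono C) simp
      finally show "cmod c \<le> (hnorm ipK y * C) * hnorm ipH z" by (simp add: mult.assoc)
    qed (auto simp: bounded_opD[OF T] K.ip_simps)
    thus ?thesis by fastforce
  qed
  then obtain S where S: "\<And>y x. ipK y (T x) = ipH (S y) x" by metis
  have S': "ipK (T x) y = ipH x (S y)" for x y
    using S[of y x] K.ip_cnj[of "T x" y] H.ip_cnj[of x "S y"] by simp
  have "\<forall>x y. ipK (T x) y = ipH x (adj ipH ipK T y)"
    unfolding adj_def
  proof (rule theI[where a = S])
    show "\<forall>x y. ipK (T x) y = ipH x (S y)" using S' by blast
  next
    fix R assume R: "\<forall>x y. ipK (T x) y = ipH x (R y)"
    show "R = S"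
    proof (rule ext, rule H.ip_ext)
      fix y x
      show "ipH (R y) x = ipH (S y) x"
        using R S' H.ip_cnj[of "R y" x] H.ip_cnj[of "S y" x] by simp
    qed
  qed
  thus ?thesis by blast
qed

text \<open>The bound comes from |T* y|^2 = <y, T T* y> <= |y| C |T* y| by cancelling one factor |T*
  y|.\<close>

lemma adj_bounded_op:
  assumes H: "hilbert scH ipH" and K: "hilbert scK ipK" and T: "bounded_op scH ipH scK ipK T"
  shows "bounded_op scK ipK scH ipH (adj ipH ipK T)"
proof -
  interpret H: hilbert scH ipH by (rule H)
  interpret K: hilbert scK ipK by (rule K)
  let ?S = "adj ipH ipK T"
  note S = adj_ip[OF H K T, symmetric]
  have S': "ipH (?S y) x = ipK y (T x)" for x y
    using S[of x y] K.ip_cnj[of "T x" y] H.ip_cnj[of x "?S y"] by simp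
  obtain C where C: "C \<ge> 0" "\<And>x. hnorm ipK (T x) \<le> C * hnorm ipH x"
    using bounded_op_bound[OF T H] by blast
  have "hnorm ipH (?S y) \<le> C * hnorm ipK y" for y
  proof -
    have "(hnorm ipH (?S y))\<^sup>2 = Re (ipK y (T (?S y)))"
      by (simp add: H.nrm_sq S')
    also have "\<dots> \<le> hnorm ipK y * hnorm ipK (T (?S y))"
      using K.Cauchy_Schwarz complex_Re_le_cmod order_trans by blast
    also have "\<dots> \<le> hnorm ipK y * (C * hnorm ipH (?S y))"
      by (intro mult_left_mono C) simp
    finally have "hnorm ipH (?S y) * hnorm ipH (?S y) \<le> (C * hnorm ipK y) * hnorm ipH (?S y)"
      by (simp add: power2_eq_square algebra_simps)
    thus ?thesis
      using C(1) by (cases "hnorm ipH (?S y) = 0")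
        (auto simp del: H.nrm_eq_0 simp: mult_le_cancel_right less_le)
  qed
  moreover have "?S (x + y) = ?S x + ?S y" for x y
    by (rule H.ip_ext) (simp add: S' H.ip_simps K.ip_simps)
  moreover have "?S (scK c x) = scH c (?S x)" for c x
    by (rule H.ip_ext) (simp add: S' H.ip_simps K.ip_simps)
  ultimately show ?thesis by (auto simp: bounded_op_def)
qed

lemma bounded_op_comp:
  assumes S: "bounded_op scK ipK scL ipL S" and T: "bounded_op scH ipH scK ipK T"
    and K: "hilbert scK ipK"
  shows "bounded_op scH ipH scL ipL (\<lambda>x. S (T x))"
proof -
  obtain C where C: "C \<ge> 0" "\<And>x. hnorm ipL (S x) \<le> C * hnorm ipK x"
    using bounded_op_bound[OF S K] by blast
  obtain D where D: "\<And>x. hnorm ipK (T x) \<le> D * hnorm ipH x"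
    using T by (auto simp: bounded_op_def)
  have "hnorm ipL (S (T x)) \<le> (C * D) * hnorm ipH x" for x
    using C(2)[of "T x"] mult_left_mono[OF D[of x] C(1)] by (simp add: mult.assoc)
  thus ?thesis
    using bounded_opD[OF S] bounded_opD[OF T] by (auto simp: bounded_op_def)
qed

lemma bounded_op_minus:
  assumes S: "bounded_op scH ipH scK ipK S" and T: "bounded_op scH ipH scK ipK T"
    and K: "hilbert scK ipK"
  shows "bounded_op scH ipH scK ipK (\<lambda>x. S x - T x)"
proof -
  interpret K: hilbert scK ipK by (rule K)
  obtain C where C: "\<And>x. hnorm ipK (S x) \<le> C * hnorm ipH x"
    using S by (auto simp: bounded_op_def)
  obtain D where D: "\<And>x. hnorm ipK (T x) \<le> D * hnorm ipH x"
    using T by (auto simp: bounded_op_def)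
  have "hnorm ipK (S x - T x) \<le> (C + D) * hnorm ipH x" for x
    using K.nrm_triangle_diff[of "S x" "T x"] C[of x] D[of x] by (simp add: distrib_right)
  thus ?thesis
    using bounded_opD[OF S] bounded_opD[OF T]
    by (auto simp: bounded_op_def K.scale_right_diff_distrib)
qed

text \<open>Polarisation over the complex numbers: the form at x + y settles the imaginary parts,
  and replacing y by i y settles the real parts. Hence \<open>pos_op\<close>, which only speaks
  about the diagonal of the form, implies self-adjointness.\<close>

lemma (in hilbert) symmetric_if_real_form:
  assumes T: "bounded_op sc ip sc ip T" and real: "\<And>x. Im (ip x (T x)) = 0"
  shows "ip (T x) y = ip x (T y)"
proof -
  have a: "Im (ip x (T y)) + Im (ip y (T x)) = 0" for x y
    using real[of "x + y"] real[of x] real[of y] by (simp add: bounded_opD[OF T] ip_simps)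
  have "Re (ip x (T y)) = Re (ip y (T x))"
    using a[of x "sc \<i> y"] by (simp add: bounded_opD[OF T] ip_simps)
  with a[of x y] ip_cnj[of "T x" y] show ?thesis by (simp add: complex_eq_iff)
qed

lemma (in hilbert) zero_if_zero_form:
  assumes T: "bounded_op sc ip sc ip T" and "\<And>x. ip x (T x) = 0"
  shows "T x = 0"
proof -
  have sym: "ip (T x) y = ip x (T y)" for x y
    using symmetric_if_real_form[OF T] assms(2) by simp
  have "ip x (T y) + ip y (T x) = 0" for x y
    using assms(2)[of "x + y"] assms(2)[of x] assms(2)[of y]
    by (simp add: bounded_opD[OF T] ip_simps add.commute)
  \<comment> \<open>By symmetry both summands equal <T x, T x>.\<close>
  from this[of x "T x"] have "ip (T x) (T x) = 0"
    using sym[of x "T x"] by simp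
  thus ?thesis by (rule ip_self_zero)
qed

section \<open>Products are total in a pro-C*-algebra\<close>

locale star_alg =
  fixes sc :: "complex \<Rightarrow> 'a::ring \<Rightarrow> 'a" and st :: "'a \<Rightarrow> 'a"
  assumes star_algebra: "star_algebra sc st"
begin

sublocale module sc
  using star_algebra by (simp add: star_algebra_def)

lemma star_add: "st (x + y) = st x + st y"
  and star_scale: "st (sc c x) = sc (cnj c) (st x)"
  and star_mult: "st (x * y) = st y * st x"
  and star_star [simp]: "st (st x) = x"
  using star_algebra unfolding star_algebra_def by simp_all

lemma star_zero [simp]: "st 0 = 0"
  using star_add[of 0 0] by simp

lemma star_diff: "st (x - y) = st x - st y"
  using star_add[of "x - y" y] by (simp add: eq_diff_eq)

context
  fixes p assumes p: "C_star_seminorm sc st p"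
begin

lemma seminorm_nonneg: "p x \<ge> 0"
  and seminorm_triangle: "p (x + y) \<le> p x + p y"
  and seminorm_scale: "p (sc c x) = cmod c * p x"
  and seminorm_mult: "p (x * y) \<le> p x * p y"
  and seminorm_star_mult: "p (st x * x) = (p x)\<^sup>2"
  using p by (simp_all add: C_star_seminorm_def)

lemma seminorm_uminus: "p (- x) = p x"
  using seminorm_scale[of "-1" x] by simp

lemma seminorm_diff: "p (x - y) \<le> p x + p y"
  using seminorm_triangle[of x "- y"] by (simp add: seminorm_uminus)

lemma seminorm_zero: "p 0 = 0"
  using seminorm_scale[of 0 0] by simp

lemma seminorm_star: "p (st x) = p x"
proof -
  have "p x \<le> p (st x)" for x
  proof (cases "p x = 0")
    case False
    have "p x * p x \<le> p (st x) * p x"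
      using seminorm_mult[of "st x" x] by (simp add: seminorm_star_mult power2_eq_square)
    thus ?thesis using False seminorm_nonneg[of x] by simp
  qed (simp add: seminorm_nonneg)
  from this[of x] this[of "st x"] show ?thesis by simp
qed

end

text \<open>In the unitisation, 1 + quasi_power y k is the k-th power of 1 + y.\<close>

primrec quasi_power :: "'a \<Rightarrow> nat \<Rightarrow> 'a" where
  "quasi_power y 0 = 0"
| "quasi_power y (Suc k) = quasi_power y k + y + y * quasi_power y k"

lemma quasi_power_commute: "y * quasi_power y k = quasi_power y k * y"
  by (induction k) (simp_all add: distrib_left distrib_right flip: mult.assoc)

text \<open>For skew y, the elements (1 + y)^k and its adjoint have product (1 - y^2)^k. If k p(y)^2
  is bounded, this keeps p((1 + y)^k - 1) bounded, although its linear term is k y.\<close>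

lemma quasi_power_skew_bound:
  assumes p: "C_star_seminorm sc st p" and skew: "st y = - y"
  defines "w \<equiv> quasi_power y"
  shows "p (st (w k) * w k + st (w k) + w k) + 1 \<le> (1 + (p y)\<^sup>2) ^ k"
proof (induction k)
  case 0
  show ?case by (simp add: w_def seminorm_zero[OF p])
next
  case (Suc k)
  define z where "z = st (w k)"
  \<comment> \<open>In the unitisation 1 + v is the product of 1 + z and 1 + w k.\<close>
  define v where "v = z * w k + z + w k"
  have "st (y * w k) = st (w k * y)"
    by (simp add: w_def quasi_power_commute)
  hence zy: "z * y = y * z"
    by (simp add: star_mult skew z_def)
  have "st (w (Suc k)) = z - y - z * y"
    by (simp add: w_def z_def star_add star_mult skew)
  \<comment> \<open>In the unitisation this reads (1 + z)(1 - y)(1 + y)(1 + w k) = (1 - y^2)(1 + v),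
    minus 1 on both sides. It needs that z commutes with y.\<close>
  moreover have "(z - y - z * y) * (w k + y + y * w k) + (z - y - z * y) + (w k + y + y * w k)
      = v - (y * y + y * y * v)"
  proof -
    have zyy: "z * (y * u) = y * (z * u)" for u
      using zy by (simp flip: mult.assoc)
    show ?thesis
      by (simp add: v_def algebra_simps zy zyy)
  qed
  ultimately have "p (st (w (Suc k)) * w (Suc k) + st (w (Suc k)) + w (Suc k))
      = p (v - (y * y + y * y * v))"
    by (simp add: w_def)
  also have "\<dots> \<le> p v + p (y * y + y * y * v)"
    by (rule seminorm_diff[OF p])
  also have "p (y * y + y * y * v) \<le> p (y * y) + p (y * y * v)"
    by (rule seminorm_triangle[OF p])
  also have "p (y * y * v) \<le> p (y * y) * p v"
    by (rule seminorm_mult[OF p])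
  also have "p (y * y) = (p y)\<^sup>2"
    using seminorm_star_mult[OF p, of y] by (simp add: skew seminorm_uminus[OF p])
  \<comment> \<open>The \<open>+ 1\<close> in the claim turns the additive recursion for p v into a
    purely multiplicative one.\<close>
  finally have "p (st (w (Suc k)) * w (Suc k) + st (w (Suc k)) + w (Suc k)) + 1
      \<le> (1 + (p y)\<^sup>2) * (p v + 1)"
    by (simp add: algebra_simps)
  also have "\<dots> \<le> (1 + (p y)\<^sup>2) * (1 + (p y)\<^sup>2) ^ k"
    using Suc.IH by (intro mult_left_mono) (auto simp: v_def z_def add.assoc)
  finally show ?case by simp
qed

text \<open>The power in the skew bound is at most exp 1 <= 3, which leaves p v <= 2. By the
  C*-identity p(w)^2 <= p v + 2 p w, and t^2 <= 2 + 2 t forces t <= 3.\<close>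

lemma quasi_power_bound:
  assumes p: "C_star_seminorm sc st p" and skew: "st y = - y"
    and small: "k * (p y)\<^sup>2 \<le> 1"
  shows "p (quasi_power y k) \<le> 3"
proof -
  define w where "w = quasi_power y k"
  define v where "v = st w * w + st w + w"
  have "p v + 1 \<le> (1 + (p y)\<^sup>2) ^ k"
    using quasi_power_skew_bound[OF p skew, of k] by (simp add: v_def w_def)
  also have "\<dots> \<le> exp ((p y)\<^sup>2) ^ k"
    by (intro power_mono) (auto simp: add_nonneg_nonneg)
  also have "\<dots> = exp (k * (p y)\<^sup>2)"
    by (simp add: exp_of_nat_mult)
  also have "\<dots> \<le> exp 1" using small by simp
  also have "\<dots> \<le> 3" by (rule exp_le)
  finally have v: "p v \<le> 2" by simp
  have "(p w)\<^sup>2 = p (v - (st w + w))"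
    by (simp add: v_def seminorm_star_mult[OF p])
  also have "\<dots> \<le> p v + p (st w + w)" by (rule seminorm_diff[OF p])
  also have "p (st w + w) \<le> p (st w) + p w" by (rule seminorm_triangle[OF p])
  also have "p (st w) = p w" by (rule seminorm_star[OF p])
  finally have "(p w)\<^sup>2 \<le> 2 + 2 * p w" using v by simp
  hence "(p w - 1)\<^sup>2 \<le> 2\<^sup>2" by (simp add: power2_diff)
  hence "p w - 1 \<le> 2" by (rule power2_le_imp_le) simp
  thus ?thesis by (simp add: w_def)
qed

end

lemma pro_C_star_neighbourhood:
  assumes A: "pro_C_star_algebra sc st \<tau>" and U: "openin \<tau> U" "0 \<in> U"
  obtains F e where "finite F" "\<forall>p\<in>F. C_star_seminorm sc st p" "e > 0"
    "\<forall>y. (\<forall>p\<in>F. p y < e) \<longrightarrow> y \<in> U"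
proof -
  have *: "\<forall>U. openin \<tau> U \<longleftrightarrow>
        (\<forall>x\<in>U. \<exists>F e. finite F \<and> F \<subseteq> cont_C_star_seminorms sc st \<tau> \<and> e > 0 \<and>
                     {y. \<forall>p\<in>F. p (y - x) < e} \<subseteq> U)"
    using A unfolding pro_C_star_algebra_def by (elim conjE)
  have "\<exists>F e. finite F \<and> F \<subseteq> cont_C_star_seminorms sc st \<tau> \<and> e > 0 \<and>
      {y. \<forall>p\<in>F. p (y - 0) < e} \<subseteq> U"
    using *[THEN spec, THEN iffD1, OF U(1)] U(2) by (rule bspec)
  then obtain F e where "finite F" "F \<subseteq> cont_C_star_seminorms sc st \<tau>" "e > 0"
    "{y. \<forall>p\<in>F. p (y - 0) < e} \<subseteq> U"
    by (elim exE conjE)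
  thus ?thesis by (intro that[of F e]) (auto simp: cont_C_star_seminorms_def)
qed

text \<open>Products are total in A, although A need not have a unit: for self-adjoint h, the element
  (1 + i s h)^k - 1 agrees with i k s h up to products and stays bounded as k s tends to
  infinity with k s^2 bounded.\<close>

lemma cont_linear_map_zero_if_zero_on_products:
  fixes sc :: "complex \<Rightarrow> 'a::ring \<Rightarrow> 'a"
  assumes A: "pro_C_star_algebra sc st \<tau>" and H: "hilbert scH ipH"
    and g: "cont_linear_map sc \<tau> scH ipH g"
    and prod: "\<And>a b x. g (a * b) x = 0"
  shows "g a x = 0"
proof -
  interpret H: hilbert scH ipH by (rule H)
  interpret star_alg sc st
    by unfold_locales (use A in \<open>simp add: pro_C_star_algebra_def\<close>)
  have g_add: "g (a + b) x = g a x + g b x" and g_scale: "g (sc c a) x = scH c (g a x)" for a b c x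
    using g by (simp_all add: cont_linear_map_def)
  have g_zero: "g 0 x = 0" for x
    using g_add[of 0 0 x] by simp
  \<comment> \<open>The terms of the quasi-power beyond the linear one k y are products, and g
    annihilates these.\<close>
  have g_quasi_power: "g (quasi_power y k) x = scH (of_nat k) (g y x)" for y k x
    by (induction k) (simp_all add: g_zero g_add prod H.scale_left_distrib add.commute)
  obtain U where U: "openin \<tau> U" "0 \<in> U"
    and gU: "\<And>b x. b \<in> U \<Longrightarrow> hnorm ipH (g b x) \<le> hnorm ipH x"
  proof -
    have "op_continuous \<tau> ipH ipH g"
      using g unfolding cont_linear_map_def by (elim conjE)
    from this[unfolded op_continuous_def, rule_format, of 1 0] that show ?thesis
      by (auto simp: g_zero)
  qed
  obtain F e where F: "finite F" "\<forall>p\<in>F. C_star_seminorm sc st p" and e: "e > 0"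
    and FU: "\<forall>y. (\<forall>p\<in>F. p y < e) \<longrightarrow> y \<in> U"
    by (rule pro_C_star_neighbourhood[OF A U])
  have self_adjoint: "g h x = 0" if h: "st h = h" for h
  proof -
    \<comment> \<open>A common bound for all p h with p in F; the summand 1 keeps P positive when
      the sum vanishes.\<close>
    define P where "P = 1 + (\<Sum>p\<in>F. p h)"
    have nn: "p h \<ge> 0" if "p \<in> F" for p
      using seminorm_nonneg[OF F(2)[rule_format, OF that]] .
    have P: "P > 0"
      unfolding P_def using nn by (simp add: add_pos_nonneg sum_nonneg)
    have pP: "p h \<le> P" if "p \<in> F" for p
      using member_le_sum[of p F "\<lambda>p. p h"] nn F(1) that by (simp add: P_def)
    have bound: "real N * hnorm ipH (g h x) \<le> 4 * P / e * hnorm ipH x" if N: "N > 0" for N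
    proof -
      \<comment> \<open>Scale and exponent are matched: p y <= 1/N for p in F, so N^2 (p y)^2 <= 1
        and the quasi-power of exponent N^2 has seminorm at most 3. Its linear term N^2 y equals (i
        N / P) h, which yields the factor N in \<open>bound\<close>. The factor e / 4 in b brings 3
        below e, so b lies in U.\<close>
      define y where "y = sc (\<i> * of_real (1 / (N * P))) h"
      define b where "b = sc (of_real (e / 4)) (quasi_power y (N\<^sup>2))"
      have "st y = - y"
        by (simp add: y_def star_scale h)
      have "p b < e" if p: "p \<in> F" for p
      proof -
        have "p y = p h / (N * P)"
          using P N by (simp add: y_def seminorm_scale[OF F(2)[rule_format, OF p]] norm_mult norm_divide)
        hence "N * p y \<le> 1" using pP[OF p] P N by simp
        moreover have "N * p y \<ge> 0" using seminorm_nonneg[OF F(2)[rule_format, OF p], of y] by simp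
        ultimately have "(N * p y)\<^sup>2 \<le> 1" by (simp add: power_le_one)
        hence "p (quasi_power y (N\<^sup>2)) \<le> 3"
          by (intro quasi_power_bound[OF F(2)[rule_format, OF p] \<open>st y = - y\<close>]) (simp add: power_mult_distrib)
        thus ?thesis
          using e by (simp add: b_def seminorm_scale[OF F(2)[rule_format, OF p]] norm_divide)
      qed
      hence "hnorm ipH (g b x) \<le> hnorm ipH x"
        by (intro gU FU[rule_format])
      moreover have "hnorm ipH (g b x) = e / 4 * ((real N)\<^sup>2 * (1 / (N * P) * hnorm ipH (g h x)))"
        using e P N
        by (simp add: b_def g_scale g_quasi_power y_def H.nrm_scale norm_mult norm_divide norm_power
            del: H.scale_scale)
      ultimately show ?thesis using e P N by (simp add: field_simps power2_eq_square)
    qed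
    have "hnorm ipH (g h x) = 0"
    proof (rule ccontr)
      assume "hnorm ipH (g h x) \<noteq> 0"
      hence "hnorm ipH (g h x) > 0" using H.nrm_ge0[of "g h x"] by linarith
      from reals_Archimedean3[OF this, rule_format, of "4 * P / e * hnorm ipH x"]
      obtain N where N: "4 * P / e * hnorm ipH x < real N * hnorm ipH (g h x)" by blast
      moreover have "4 * P / e * hnorm ipH x \<ge> 0" using P e by simp
      ultimately have "N > 0" by (intro gr0I) auto
      from bound[OF this] N show False by linarith
    qed
    thus ?thesis by simp
  qed
  have g_diff: "g (b - c) x = g b x - g c x" for b c
    using g_add[of "b - c" c x] by (simp add: eq_diff_eq)
  have "g (a + st a) x = 0"
    by (rule self_adjoint) (simp add: star_add add.commute)
  moreover have "g (sc \<i> (a - st a)) x = 0"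
    by (rule self_adjoint) (simp add: star_scale star_diff scale_right_diff_distrib)
  hence "scH (- \<i>) (scH \<i> (g (a - st a) x)) = 0"
    by (simp add: g_scale)
  hence "g (a - st a) x = 0" by simp
  ultimately have "scH 2 (g a x) = 0"
    using H.scale_left_distrib[of 1 1 "g a x"] by (simp add: g_add g_diff eq_neg_iff_add_eq_0)
  from arg_cong[OF this, of "scH (1/2)"] show ?thesis by simp
qed

section \<open>Dense subsets of a Hilbert space\<close>

context hilbert
begin

lemma dense_sequence:
  assumes "\<forall>y e. e > 0 \<longrightarrow> (\<exists>z\<in>Z. nrm (y - z) < e)"
  obtains z where "\<forall>k. z k \<in> Z" "(\<lambda>k. nrm (z k - y)) \<longlonglongrightarrow> 0"
proof -
  have "\<forall>k. \<exists>z\<in>Z. nrm (y - z) < inverse (real (Suc k))"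
    using assms by simp
  then obtain z where z: "\<And>k. z k \<in> Z" "\<And>k. nrm (y - z k) < inverse (real (Suc k))"
    by metis
  have "(\<lambda>k. nrm (z k - y)) \<longlonglongrightarrow> 0"
  proof (rule real_tendsto_sandwich[OF _ _ tendsto_const LIMSEQ_inverse_real_of_nat])
    show "\<forall>\<^sub>F k in sequentially. nrm (z k - y) \<le> inverse (real (Suc k))"
      using z(2) by (intro always_eventually allI) (simp add: nrm_minus_commute[of _ y] less_imp_le)
  qed simp
  thus ?thesis using z(1) that by blast
qed

lemma tendsto_form:
  assumes z: "(\<lambda>k. nrm (z k - y)) \<longlonglongrightarrow> 0" and T: "bounded_op sc ip sc ip T"
  shows "(\<lambda>k. ip (z k) (T (z k))) \<longlonglongrightarrow> ip y (T y)"
proof (rule LIM_zero_cancel)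
  obtain C where C: "C \<ge> 0" "\<And>x. nrm (T x) \<le> C * nrm x"
    using bounded_op_bound[OF T hilbert_axioms] by blast
  have "cmod (ip (z k) (T (z k)) - ip y (T y))
      \<le> nrm (z k - y) * (C * (nrm (z k - y) + nrm y)) + nrm y * (C * nrm (z k - y))" for k
  proof -
    have "ip (z k) (T (z k)) - ip y (T y) = ip (z k - y) (T (z k)) + ip y (T (z k - y))"
      by (simp add: bounded_op_diff[OF T] ip_diff_left ip_diff_right)
    hence "cmod (ip (z k) (T (z k)) - ip y (T y))
        \<le> cmod (ip (z k - y) (T (z k))) + cmod (ip y (T (z k - y)))"
      using norm_triangle_ineq by simp
    moreover have "cmod (ip (z k - y) (T (z k))) \<le> nrm (z k - y) * (C * (nrm (z k - y) + nrm y))"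
    proof -
      have "nrm (T (z k)) \<le> C * (nrm (z k - y) + nrm y)"
        using C(2)[of "z k"] mult_left_mono[OF nrm_triangle[of "z k - y" y] C(1)] by simp
      thus ?thesis
        by (intro order_trans[OF Cauchy_Schwarz] mult_left_mono) auto
    qed
    moreover have "cmod (ip y (T (z k - y))) \<le> nrm y * (C * nrm (z k - y))"
      by (intro order_trans[OF Cauchy_Schwarz] mult_left_mono C(2)) auto
    ultimately show ?thesis by linarith
  qed
  hence "\<forall>\<^sub>F k in sequentially. norm (ip (z k) (T (z k)) - ip y (T y))
      \<le> nrm (z k - y) * (C * (nrm (z k - y) + nrm y)) + nrm y * (C * nrm (z k - y))"
    by (intro always_eventually allI)
  moreover have "(\<lambda>k. nrm (z k - y) * (C * (nrm (z k - y) + nrm y)) + nrm y * (C * nrm (z k - y)))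
      \<longlonglongrightarrow> 0 * (C * (0 + nrm y)) + nrm y * (C * 0)"
    by (intro tendsto_intros z)
  hence "(\<lambda>k. nrm (z k - y) * (C * (nrm (z k - y) + nrm y)) + nrm y * (C * nrm (z k - y)))
      \<longlonglongrightarrow> 0" by (simp only: mult_zero_left mult_zero_right add_0_left)
  ultimately show "(\<lambda>k. ip (z k) (T (z k)) - ip y (T y)) \<longlonglongrightarrow> 0"
    by (rule Lim_null_comparison)
qed

context
  fixes Z assumes dense: "\<forall>y e. e > 0 \<longrightarrow> (\<exists>z\<in>Z. nrm (y - z) < e)"
begin

lemma pos_op_if_dense:
  assumes T: "bounded_op sc ip sc ip T"
    and pos: "\<And>z. z \<in> Z \<Longrightarrow> Im (ip z (T z)) = 0 \<and> Re (ip z (T z)) \<ge> 0"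
  shows "pos_op ip T"
  unfolding pos_op_def
proof
  fix y
  obtain z where z: "\<forall>k. z k \<in> Z" "(\<lambda>k. nrm (z k - y)) \<longlonglongrightarrow> 0"
    by (rule dense_sequence[OF dense])
  note lim = tendsto_form[OF z(2) T]
  have "(\<lambda>k. 0) \<longlonglongrightarrow> Im (ip y (T y))"
    using tendsto_Im[OF lim] pos[OF z(1)[rule_format]] by simp
  moreover have "Re (ip y (T y)) \<ge> 0"
    by (rule LIMSEQ_le_const[OF tendsto_Re[OF lim]]) (use pos[OF z(1)[rule_format]] in auto)
  ultimately show "Im (ip y (T y)) = 0 \<and> Re (ip y (T y)) \<ge> 0"
    by (simp add: LIMSEQ_const_iff)
qed

text \<open>By density the quadratic form of S - T vanishes everywhere, and over the complex numbers
  the quadratic form determines the operator.\<close>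

lemma bounded_op_eq_if_dense:
  assumes S: "bounded_op sc ip sc ip S" and T: "bounded_op sc ip sc ip T"
    and eq: "\<And>z. z \<in> Z \<Longrightarrow> S z = T z"
  shows "S = T"
proof
  fix x
  have D: "bounded_op sc ip sc ip (\<lambda>x. S x - T x)"
    by (rule bounded_op_minus[OF S T hilbert_axioms])
  have "ip y (S y - T y) = 0" for y
  proof -
    obtain z where z: "\<forall>k. z k \<in> Z" "(\<lambda>k. nrm (z k - y)) \<longlonglongrightarrow> 0"
      by (rule dense_sequence[OF dense])
    show ?thesis
      using tendsto_form[OF z(2) D] eq[OF z(1)[rule_format]] by (simp add: LIMSEQ_const_iff)
  qed
  from zero_if_zero_form[OF D this] show "S x = T x" by simp
qed

lemma ip_ext_dense:
  assumes "\<And>z. z \<in> Z \<Longrightarrow> ip x z = ip y z"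
  shows "x = y"
proof -
  obtain z where z: "\<forall>k. z k \<in> Z" "(\<lambda>k. nrm (z k - (x - y))) \<longlonglongrightarrow> 0"
    by (rule dense_sequence[OF dense])
  have "ip (z k) (x - y) = 0" for k
    using assms[OF z(1)[rule_format, of k]] ip_cnj[of "z k" "x - y"] by (simp add: ip_diff_left)
  hence "ip (x - y) (x - y) = 0"
    using tendsto_ip[OF z(2), of "x - y"] by (simp add: LIMSEQ_const_iff)
  thus ?thesis using ip_self_zero by fastforce
qed

text \<open>Supplies the norm bound that \<open>Riesz_on_subspace\<close> does not give: test y
  against members of Z approaching y, where |<y, z>| tends to |y|^2.\<close>

lemma nrm_le_if_dense:
  assumes C: "C \<ge> 0" and bound: "\<And>z. z \<in> Z \<Longrightarrow> cmod (ip y z) \<le> C * nrm z"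
  shows "nrm y \<le> C"
proof -
  obtain z where z: "\<forall>k. z k \<in> Z" "(\<lambda>k. nrm (z k - y)) \<longlonglongrightarrow> 0"
    by (rule dense_sequence[OF dense])
  have "(\<lambda>k. cmod (ip (z k) y)) \<longlonglongrightarrow> cmod (ip y y)"
    by (intro tendsto_norm tendsto_ip z(2))
  moreover have "(\<lambda>k. C * (nrm (z k - y) + nrm y)) \<longlonglongrightarrow> C * (0 + nrm y)"
    by (intro tendsto_intros z(2))
  moreover have "cmod (ip (z k) y) \<le> C * (nrm (z k - y) + nrm y)" for k
  proof -
    have "cmod (ip (z k) y) \<le> C * nrm (z k)"
      using bound[OF z(1)[rule_format, of k]] ip_cnj[of "z k" y] by simp
    also have "\<dots> \<le> C * (nrm (z k - y) + nrm y)"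
      using nrm_triangle[of "z k - y" y] C by (intro mult_left_mono) auto
    finally show ?thesis .
  qed
  ultimately have "cmod (ip y y) \<le> C * (0 + nrm y)"
    by (intro LIMSEQ_le) auto
  hence "nrm y * nrm y \<le> C * nrm y"
    by (simp add: ip_self power2_eq_square norm_mult)
  thus ?thesis
    using C nrm_ge0[of y] by (cases "nrm y = 0") (auto simp del: nrm_eq_0 simp: mult_le_cancel_right less_le)
qed

end

end

lemma cont_linear_map_diff:
  assumes H: "hilbert scH ipH"
    and f: "cont_linear_map sc \<tau> scH ipH f" and g: "cont_linear_map sc \<tau> scH ipH g"
  shows "cont_linear_map sc \<tau> scH ipH (\<lambda>a x. f a x - g a x)"
proof -
  interpret H: hilbert scH ipH by (rule H)
  have f': "bounded_op scH ipH scH ipH (f a)" "f (a + b) = (\<lambda>x. f a x + f b x)"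
    "f (sc c a) = (\<lambda>x. scH c (f a x))" "op_continuous \<tau> ipH ipH f" for a b c
    using f by (simp_all add: cont_linear_map_def)
  have g': "bounded_op scH ipH scH ipH (g a)" "g (a + b) = (\<lambda>x. g a x + g b x)"
    "g (sc c a) = (\<lambda>x. scH c (g a x))" "op_continuous \<tau> ipH ipH g" for a b c
    using g by (simp_all add: cont_linear_map_def)
  have "op_continuous \<tau> ipH ipH (\<lambda>a x. f a x - g a x)"
    unfolding op_continuous_def
  proof (intro allI impI)
    fix a and e :: real assume "e > 0"
    hence e: "e / 2 > 0" by simp
    from f'(4)[unfolded op_continuous_def, THEN spec, THEN spec, THEN mp, OF e]
    obtain U where U: "openin \<tau> U \<and> a \<in> U \<and> (\<forall>b\<in>U. \<forall>x. H.nrm (f b x - f a x) \<le> e / 2 * H.nrm x)" ..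
    from g'(4)[unfolded op_continuous_def, THEN spec, THEN spec, THEN mp, OF e]
    obtain W where W: "openin \<tau> W \<and> a \<in> W \<and> (\<forall>b\<in>W. \<forall>x. H.nrm (g b x - g a x) \<le> e / 2 * H.nrm x)" ..
    have "H.nrm (f b x - g b x - (f a x - g a x)) \<le> e * H.nrm x" if "b \<in> U \<inter> W" for b x
    proof -
      have "f b x - g b x - (f a x - g a x) = (f b x - f a x) - (g b x - g a x)" by simp
      hence "H.nrm (f b x - g b x - (f a x - g a x)) \<le> H.nrm (f b x - f a x) + H.nrm (g b x - g a x)"
        by (simp only: H.nrm_triangle_diff)
      also have "\<dots> \<le> e / 2 * H.nrm x + e / 2 * H.nrm x"
        using U W that by (intro add_mono) auto
      finally show ?thesis by (simp add: field_simps)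
    qed
    thus "\<exists>U. openin \<tau> U \<and> a \<in> U \<and>
        (\<forall>b\<in>U. \<forall>x. H.nrm (f b x - g b x - (f a x - g a x)) \<le> e * H.nrm x)"
      using U W by (intro exI[of _ "U \<inter> W"]) auto
  qed
  moreover have "bounded_op scH ipH scH ipH (\<lambda>x. f a x - g a x)" for a
    by (rule bounded_op_minus[OF f'(1) g'(1) H])
  ultimately show ?thesis
    by (auto simp: cont_linear_map_def f'(2,3) g'(2,3) fun_eq_iff H.scale_right_diff_distrib)
qed

section \<open>Gram forms of completely n-positive maps\<close>

lemma cont_linear_mapD:
  assumes "cont_linear_map sc \<tau> scH ipH f"
  shows "bounded_op scH ipH scH ipH (f a)" "f (a + b) x = f a x + f b x"
    "f (sc c a) x = scH c (f a x)" "op_continuous \<tau> ipH ipH f"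
  using assms by (simp_all add: cont_linear_map_def)

text \<open>A vector of C^n (x) A (x) H is encoded as a list of triples (i, a, xi), standing for the sum
  of the elementary tensors e_i (x) a (x) xi.\<close>

definition gram :: "('a::ring \<Rightarrow> 'a) \<Rightarrow> ('h \<Rightarrow> 'h \<Rightarrow> complex) \<Rightarrow> (nat \<Rightarrow> nat \<Rightarrow> 'a \<Rightarrow> 'h \<Rightarrow> 'h) \<Rightarrow>
    (nat \<times> 'a \<times> 'h) list \<Rightarrow> (nat \<times> 'a \<times> 'h) list \<Rightarrow> complex" where
  "gram st ip \<theta> L M = (\<Sum>(i, a, x)\<leftarrow>L. \<Sum>(j, b, y)\<leftarrow>M. ip x (\<theta> i j (st a * b) y))"

definition indexed :: "nat \<Rightarrow> (nat \<times> 'a \<times> 'h) list \<Rightarrow> bool" where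
  "indexed n L \<longleftrightarrow> (\<forall>(i, a, x)\<in>set L. i < n)"

lemma indexed_simps [simp]:
  "indexed n []"
  "indexed n ((i, a, x) # L) \<longleftrightarrow> i < n \<and> indexed n L"
  "indexed n (L @ M) \<longleftrightarrow> indexed n L \<and> indexed n M"
  by (auto simp: indexed_def)

lemma gram_Cons_left: "gram st ip \<theta> ((i, a, x) # L) M = gram st ip \<theta> [(i, a, x)] M + gram st ip \<theta> L M"
  by (simp add: gram_def)

lemma gram_append_left: "gram st ip \<theta> (L @ L') M = gram st ip \<theta> L M + gram st ip \<theta> L' M"
  by (simp add: gram_def)

lemma gram_append_right: "gram st ip \<theta> L (M @ M') = gram st ip \<theta> L M + gram st ip \<theta> L M'"
  by (simp add: gram_def sum_list_addf split_def)

text \<open>Only the row of B with index (0, 0) is non-zero.\<close>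

lemma cn_positive_gram:
  fixes sc :: "complex \<Rightarrow> 'a::ring \<Rightarrow> 'a"
  assumes A: "star_alg sc st" and H: "hilbert scH ipH"
    and \<theta>: "cn_positive sc st \<tau> scH ipH n \<theta>" and L: "indexed n L"
  shows "Im (gram st ipH \<theta> L L) = 0 \<and> Re (gram st ipH \<theta> L L) \<ge> 0"
proof (cases "L = []")
  case True
  thus ?thesis by (simp add: gram_def)
next
  case False
  interpret star_alg sc st by (rule A)
  interpret H: hilbert scH ipH by (rule H)
  define m where "m = length L"
  define ix where "ix = (\<lambda>k. fst (L ! k))"
  define a where "a = (\<lambda>k. fst (snd (L ! k)))"
  define x where "x = (\<lambda>k. snd (snd (L ! k)))"
  \<comment> \<open>The k-th triple of L occupies column (k, ix k) of this row, so B* B has the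
    entries st (a k) * a l at the positions selected by ix and 0 elsewhere.\<close>
  define B where "B = (\<lambda>r (k, i). if r = (0::nat, 0::nat) \<and> i = ix k then a k else 0)"
  define I where "I = {..<m} \<times> {..<n}"
  define G where "G = (\<lambda>k l. ipH (x k) (\<theta> (ix k) (ix l) (st (a k) * a l) (x l)))"
  \<comment> \<open>Together with n > 0 this puts the row index (0, 0) into I, which would be empty
    for the empty list.\<close>
  have m: "m > 0" using False by (simp add: m_def)
  have ix: "ix k < n" if "k < m" for k
    using L nth_mem[of k L] that unfolding indexed_def ix_def m_def by (auto simp: split_def)
  have n: "n > 0" using ix[OF m] by simp
  have \<theta>0: "\<theta> i j 0 y = 0" if "i < n" "j < n" for i j y
  proof -
    have "cont_linear_map sc \<tau> scH ipH (\<theta> i j)"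
      using \<theta>[unfolded cn_positive_def, THEN conjunct1] that by simp
    from cont_linear_mapD(2)[OF this, of 0 0 y] show ?thesis by simp
  qed
  have X: "(\<Sum>r\<in>I. st (B r (k, i)) * B r (l, j)) = (if i = ix k \<and> j = ix l then st (a k) * a l else 0)"
    for k i l j
  proof -
    have "(\<Sum>r\<in>I. st (B r (k, i)) * B r (l, j))
        = (\<Sum>r\<in>I. if r = (0, 0) then (if i = ix k \<and> j = ix l then st (a k) * a l else 0) else 0)"
      by (intro sum.cong) (auto simp: B_def)
    also have "\<dots> = (if i = ix k \<and> j = ix l then st (a k) * a l else 0)"
      using m n by (simp add: I_def)
    finally show ?thesis .
  qed
  have "(let I = {..<m} \<times> {..<n};
            X = (\<lambda>(k, i) (l, j). \<Sum>r\<in>I. st (B r (k, i)) * B r (l, j));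
            s = (\<Sum>(k, i)\<in>I. \<Sum>(l, j)\<in>I. ipH (x k) (\<theta> i j (X (k, i) (l, j)) (x l)))
        in Im s = 0 \<and> Re s \<ge> 0)"
    using \<theta>[unfolded cn_positive_def, THEN conjunct2, THEN spec[of _ m], THEN spec[of _ B],
      THEN spec[of _ "\<lambda>(k, i). x k"]]
    by (simp only: prod.case)
  moreover have "(\<Sum>(k, i)\<in>I. \<Sum>(l, j)\<in>I. ipH (x k) (\<theta> i j (\<Sum>r\<in>I. st (B r (k, i)) * B r (l, j)) (x l)))
      = gram st ipH \<theta> L L"
  proof -
    have "(\<Sum>(k, i)\<in>I. \<Sum>(l, j)\<in>I. ipH (x k) (\<theta> i j (\<Sum>r\<in>I. st (B r (k, i)) * B r (l, j)) (x l)))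
        = (\<Sum>(k, i)\<in>I. \<Sum>(l, j)\<in>I. if i = ix k then if j = ix l then G k l else 0 else 0)"
      unfolding X by (intro sum.cong refl) (auto simp: G_def I_def \<theta>0 intro!: sum.cong)
    also have "\<dots> = (\<Sum>k<m. \<Sum>i<n. if i = ix k then (\<Sum>l<m. \<Sum>j<n. if j = ix l then G k l else 0) else 0)"
      unfolding I_def sum.cartesian_product[symmetric] by (intro sum.cong refl) auto
    also have "\<dots> = (\<Sum>k<m. \<Sum>l<m. G k l)"
      using ix by simp
    also have "\<dots> = gram st ipH \<theta> L L"
      by (simp add: gram_def sum_list_sum_nth G_def ix_def a_def x_def m_def split_def atLeast0LessThan)
    finally show ?thesis .
  qed
  ultimately show ?thesis by (simp only: I_def Let_def prod.case)
qed

section \<open>Compressions of the commutant\<close>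

locale stinespring = A: star_alg sc st + H: hilbert scH ipH + K: hilbert scK ipK
  for sc :: "complex \<Rightarrow> 'a::ring \<Rightarrow> 'a" and st
    and scH :: "complex \<Rightarrow> 'h::ab_group_add \<Rightarrow> 'h" and ipH
    and scK :: "complex \<Rightarrow> 'k::ab_group_add \<Rightarrow> 'k" and ipK +
  fixes \<tau> n \<rho> \<Phi> V
  assumes algebra: "pro_C_star_algebra sc st \<tau>"
    and stine: "stinespring_rep sc st \<tau> scH ipH n \<rho> scK ipK \<Phi> V"
begin

abbreviation W where "W i \<equiv> adj ipH ipK (V i)"

lemma \<Phi>_representation: "representation sc st \<tau> scK ipK \<Phi>"
  and V_bounded: "i < n \<Longrightarrow> bounded_op scH ipH scK ipK (V i)"
  and \<rho>_eq: "i < n \<Longrightarrow> j < n \<Longrightarrow> \<rho> i j a = W i \<circ> \<Phi> a \<circ> V j"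
  using stine by (simp_all add: stinespring_rep_def)

lemma \<Phi>_cont_linear: "cont_linear_map sc \<tau> scK ipK \<Phi>"
  using \<Phi>_representation by (simp add: representation_def)

lemmas \<Phi>_bounded = cont_linear_mapD(1)[OF \<Phi>_cont_linear]

lemma \<Phi>_mult: "\<Phi> (a * b) x = \<Phi> a (\<Phi> b x)"
  using \<Phi>_representation by (simp add: representation_def)

lemma \<Phi>_ip: "ipK (\<Phi> a x) y = ipK x (\<Phi> (st a) y)"
proof -
  have "\<Phi> (st a) = adj ipK ipK (\<Phi> a)"
    using \<Phi>_representation by (simp add: representation_def)
  thus ?thesis
    using adj_ip[OF K.hilbert_axioms K.hilbert_axioms \<Phi>_bounded] by simp
qed

lemma \<Phi>_sum: "\<Phi> (\<Sum>r\<in>I. f r) x = (\<Sum>r\<in>I. \<Phi> (f r) x)"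
proof (induction I rule: infinite_finite_induct)
  have "\<Phi> 0 x = 0"
    using cont_linear_mapD(2)[OF \<Phi>_cont_linear, of 0 0 x] by simp
  thus "\<Phi> (sum f {}) x = (\<Sum>r\<in>{}. \<Phi> (f r) x)" "\<And>I. infinite I \<Longrightarrow> \<Phi> (sum f I) x = (\<Sum>r\<in>I. \<Phi> (f r) x)"
    by simp_all
qed (simp add: cont_linear_mapD(2)[OF \<Phi>_cont_linear])

lemma V_ip: "i < n \<Longrightarrow> ipK (V i x) y = ipH x (W i y)"
  by (rule adj_ip[OF H.hilbert_axioms K.hilbert_axioms V_bounded])

lemma W_bounded: "i < n \<Longrightarrow> bounded_op scK ipK scH ipH (W i)"
  by (rule adj_bounded_op[OF H.hilbert_axioms K.hilbert_axioms V_bounded])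

section \<open>Vectors of K given by lists\<close>

definition vector_of :: "(nat \<times> 'a \<times> 'h) list \<Rightarrow> 'k" where
  "vector_of L = (\<Sum>(i, a, x)\<leftarrow>L. \<Phi> a (V i x))"

lemma vector_of_simps [simp]:
  "vector_of [] = 0"
  "vector_of ((i, a, x) # L) = \<Phi> a (V i x) + vector_of L"
  "vector_of (L @ M) = vector_of L + vector_of M"
  by (simp_all add: vector_of_def)

text \<open>The scalar acts on the factor H of the tensor: then conjugate-linearity of a Gram form
  on the left is just that of the inner product, and linearity on the right is linearity of each
  operator.\<close>

definition smul :: "complex \<Rightarrow> (nat \<times> 'a \<times> 'h) list \<Rightarrow> (nat \<times> 'a \<times> 'h) list" where
  "smul c = map (\<lambda>(i, a, x). (i, a, scH c x))"

definition act :: "'a \<Rightarrow> (nat \<times> 'a \<times> 'h) list \<Rightarrow> (nat \<times> 'a \<times> 'h) list" where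
  "act b = map (\<lambda>(i, a, x). (i, b * a, x))"

lemma smul_simps [simp]: "smul c [] = []" "smul c ((i, a, x) # L) = (i, a, scH c x) # smul c L"
  by (simp_all add: smul_def)

lemma act_simps [simp]: "act b [] = []" "act b ((i, a, x) # L) = (i, b * a, x) # act b L"
  by (simp_all add: act_def)

lemma indexed_smul [simp]: "indexed n (smul c L) \<longleftrightarrow> indexed n L"
  by (induction L) auto

lemma indexed_act [simp]: "indexed n (act b L) \<longleftrightarrow> indexed n L"
  by (induction L) auto

lemma vector_of_smul: "indexed n L \<Longrightarrow> vector_of (smul c L) = scK c (vector_of L)"
  by (induction L)
    (auto simp: bounded_opD(2)[OF V_bounded] bounded_opD(2)[OF \<Phi>_bounded] K.scale_right_distrib)

lemma vector_of_act: "vector_of (act b L) = \<Phi> b (vector_of L)"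
  by (induction L)
    (auto simp: bounded_op_zero[OF \<Phi>_bounded] bounded_opD(1)[OF \<Phi>_bounded] \<Phi>_mult)

lemma vector_of_dense: "\<forall>y e. e > 0 \<longrightarrow> (\<exists>z\<in>vector_of ` Collect (indexed n). K.nrm (y - z) < e)"
proof -
  let ?G = "{\<Phi> a (V i \<xi>) | a i \<xi>. i < n}"
  have "K.span ?G \<subseteq> vector_of ` Collect (indexed n)"
  proof (rule K.span_minimal)
    show "?G \<subseteq> vector_of ` Collect (indexed n)"
    proof
      fix z assume "z \<in> ?G"
      then obtain a i \<xi> where "z = \<Phi> a (V i \<xi>)" "i < n" by blast
      hence "z = vector_of [(i, a, \<xi>)]" "indexed n [(i, a, \<xi>)]" by simp_all
      thus "z \<in> vector_of ` Collect (indexed n)" by blast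
    qed
    show "K.subspace (vector_of ` Collect (indexed n))"
    proof (rule K.subspaceI)
      show "0 \<in> vector_of ` Collect (indexed n)" by (rule image_eqI[of _ _ "[]"]) simp_all
    next
      fix x y assume "x \<in> vector_of ` Collect (indexed n)" "y \<in> vector_of ` Collect (indexed n)"
      then obtain L M where "x = vector_of L" "indexed n L" "y = vector_of M" "indexed n M" by blast
      thus "x + y \<in> vector_of ` Collect (indexed n)" by (intro image_eqI[of _ _ "L @ M"]) simp_all
    next
      fix c x assume "x \<in> vector_of ` Collect (indexed n)"
      then obtain L where "x = vector_of L" "indexed n L" by blast
      thus "scK c x \<in> vector_of ` Collect (indexed n)"
        by (intro image_eqI[of _ _ "smul c L"]) (simp_all add: vector_of_smul)
    qed
  qed
  moreover have "\<forall>y e. e > 0 \<longrightarrow> (\<exists>z\<in>K.span ?G. K.nrm (y - z) < e)"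
    using stine unfolding stinespring_rep_def by (elim conjE)
  ultimately show ?thesis by (meson subsetD)
qed

lemma commutant_bounded: "D \<in> commutant scK ipK \<Phi> \<Longrightarrow> bounded_op scK ipK scK ipK D"
  by (simp add: commutant_def)

lemma commutant_commute: "D \<in> commutant scK ipK \<Phi> \<Longrightarrow> D (\<Phi> a x) = \<Phi> a (D x)"
  unfolding commutant_def by (auto dest!: fun_cong[of _ _ x] simp: fun_eq_iff)

lemma commutant_diff:
  assumes "S \<in> commutant scK ipK \<Phi>" "T \<in> commutant scK ipK \<Phi>"
  shows "(\<lambda>x. T x - S x) \<in> commutant scK ipK \<Phi>"
  using bounded_op_minus[OF commutant_bounded commutant_bounded K.hilbert_axioms, OF assms(2,1)] assms
  by (auto simp: commutant_def[of scK ipK \<Phi>] fun_eq_iff bounded_op_diff[OF \<Phi>_bounded])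

lemma commutant_id: "id \<in> commutant scK ipK \<Phi>"
  by (auto simp: commutant_def bounded_op_def intro!: exI[of _ 1])

lemma cont_linear_compression:
  assumes D: "bounded_op scK ipK scK ipK D" and i: "i < n" and j: "j < n"
  shows "cont_linear_map sc \<tau> scH ipH (\<lambda>a x. W i (D (\<Phi> a (V j x))))"
proof -
  have WD: "bounded_op scK ipK scH ipH (\<lambda>x. W i (D x))"
    by (rule bounded_op_comp[OF W_bounded[OF i] D K.hilbert_axioms])
  obtain B where B: "B \<ge> 0" "\<And>x. H.nrm (W i (D x)) \<le> B * K.nrm x"
    using bounded_op_bound[OF WD K.hilbert_axioms] by blast
  obtain C where C: "C \<ge> 0" "\<And>x. K.nrm (V j x) \<le> C * H.nrm x"
    using bounded_op_bound[OF V_bounded[OF j] H.hilbert_axioms] by blast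
  have "op_continuous \<tau> ipH ipH (\<lambda>a x. W i (D (\<Phi> a (V j x))))"
    unfolding op_continuous_def
  proof (intro allI impI)
    fix a and e :: real assume e: "e > 0"
    \<comment> \<open>The 1 keeps the denominator positive when B * C = 0.\<close>
    define d where "d = e / (B * C + 1)"
    have BC: "B * C + 1 > 0" using B(1) C(1) by (simp add: add_nonneg_pos)
    hence d: "d > 0" using e by (simp add: d_def)
    from cont_linear_mapD(4)[OF \<Phi>_cont_linear, unfolded op_continuous_def, THEN spec, THEN spec, THEN mp, OF d]
    obtain U where U: "openin \<tau> U \<and> a \<in> U \<and> (\<forall>b\<in>U. \<forall>x. K.nrm (\<Phi> b x - \<Phi> a x) \<le> d * K.nrm x)" ..
    have "H.nrm (W i (D (\<Phi> b (V j x))) - W i (D (\<Phi> a (V j x)))) \<le> e * H.nrm x" if b: "b \<in> U" for b x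
    proof -
      have "H.nrm (W i (D (\<Phi> b (V j x))) - W i (D (\<Phi> a (V j x))))
          \<le> B * K.nrm (\<Phi> b (V j x) - \<Phi> a (V j x))"
        using B(2)[of "\<Phi> b (V j x) - \<Phi> a (V j x)"] by (simp add: bounded_op_diff[OF WD])
      also have "\<dots> \<le> B * (d * (C * H.nrm x))"
      proof (rule mult_left_mono[OF _ B(1)])
        have "K.nrm (\<Phi> b (V j x) - \<Phi> a (V j x)) \<le> d * K.nrm (V j x)"
          using U b by simp
        also have "\<dots> \<le> d * (C * H.nrm x)"
          using d by (intro mult_left_mono C) simp
        finally show "K.nrm (\<Phi> b (V j x) - \<Phi> a (V j x)) \<le> d * (C * H.nrm x)" .
      qed
      also have "\<dots> = (d * (B * C)) * H.nrm x" by (simp add: mult_ac)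
      also have "\<dots> \<le> e * H.nrm x"
      proof (rule mult_right_mono)
        have "d * (B * C) \<le> d * (B * C + 1)" using d by (intro mult_left_mono) auto
        also have "\<dots> = e" using BC by (simp add: d_def)
        finally show "d * (B * C) \<le> e" .
      qed simp
      finally show ?thesis .
    qed
    thus "\<exists>U. openin \<tau> U \<and> a \<in> U \<and> (\<forall>b\<in>U. \<forall>x. H.nrm (W i (D (\<Phi> b (V j x))) - W i (D (\<Phi> a (V j x)))) \<le> e * H.nrm x)"
      using U by (intro exI[of _ U]) simp
  qed
  moreover have "bounded_op scH ipH scH ipH (\<lambda>x. W i (D (\<Phi> a (V j x))))" for a
    using bounded_op_comp[OF WD bounded_op_comp[OF \<Phi>_bounded V_bounded[OF j] K.hilbert_axioms] K.hilbert_axioms] .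
  ultimately show ?thesis
    by (simp add: cont_linear_map_def cont_linear_mapD(2,3)[OF \<Phi>_cont_linear] bounded_opD[OF WD])
qed

context
  fixes D \<theta>
  assumes D: "D \<in> commutant scK ipK \<Phi>"
    and \<theta>: "\<And>i j a x. i < n \<Longrightarrow> j < n \<Longrightarrow> \<theta> i j a x = W i (D (\<Phi> a (V j x)))"
begin

text \<open>This is where commutation enters: \<open>\<Phi> (st a)\<close> passes through D and then
  moves to the left argument as \<open>\<Phi> a\<close>.\<close>

lemma compression_ip:
  assumes "i < n" "j < n"
  shows "ipH x (\<theta> i j (st a * b) y) = ipK (\<Phi> a (V i x)) (D (\<Phi> b (V j y)))"
  using assms by (simp add: \<theta> \<Phi>_mult commutant_commute[OF D] \<Phi>_ip flip: V_ip)

lemma gram_compression: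
  assumes L: "indexed n L" and M: "indexed n M"
  shows "gram st ipH \<theta> L M = ipK (vector_of L) (D (vector_of M))"
proof -
  have "gram st ipH \<theta> [(i, a, x)] M = ipK (\<Phi> a (V i x)) (D (vector_of M))" if "i < n" for i a x
    using M
  proof (induction M)
    case Nil
    show ?case by (simp add: gram_def bounded_op_zero[OF commutant_bounded[OF D]])
  next
    case (Cons t M)
    obtain j b y where [simp]: "t = (j, b, y)" by (cases t)
    show ?case
      using Cons that
      by (simp add: gram_def compression_ip bounded_opD(1)[OF commutant_bounded[OF D]] K.ip_add_right)
  qed
  with L show ?thesis
  proof (induction L)
    case Nil
    show ?case by (simp add: gram_def)
  next
    case (Cons t L)
    obtain i a x where [simp]: "t = (i, a, x)" by (cases t)
    show ?case
      using Cons gram_Cons_left[of st ipH \<theta> i a x L M] by (simp add: K.ip_add_left)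
  qed
qed

lemma cn_positive_if_pos_op:
  assumes pos: "pos_op ipK D"
  shows "cn_positive sc st \<tau> scH ipH n \<theta>"
proof -
  have "cont_linear_map sc \<tau> scH ipH (\<theta> i j)" if "i < n" "j < n" for i j
  proof -
    have "\<theta> i j = (\<lambda>a x. W i (D (\<Phi> a (V j x))))"
      using \<theta>[OF that] by (simp add: fun_eq_iff)
    thus ?thesis
      using cont_linear_compression[OF commutant_bounded[OF D] that] by simp
  qed
  moreover have "Im s = 0 \<and> Re s \<ge> 0"
    if s: "s = (\<Sum>(k, i)\<in>I. \<Sum>(l, j)\<in>I. ipH (\<xi> (k, i)) (\<theta> i j (\<Sum>r\<in>I. st (B r (k, i)) * B r (l, j)) (\<xi> (l, j))))"
      and I: "I = {..<m} \<times> {..<n}"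
    for m and B :: "nat \<times> nat \<Rightarrow> nat \<times> nat \<Rightarrow> 'a" and \<xi> s I
  proof -
    \<comment> \<open>w r is row r of B applied to the vectors \<open>\<xi>\<close>; the whole
      double sum becomes the sum over r of <w r, D (w r)>.\<close>
    define w where "w = (\<lambda>r. \<Sum>p\<in>I. \<Phi> (B r p) (V (snd p) (\<xi> p)))"
    have summand: "ipH (\<xi> p) (\<theta> (snd p) (snd q) (\<Sum>r\<in>I. st (B r p) * B r q) (\<xi> q))
        = (\<Sum>r\<in>I. ipK (\<Phi> (B r p) (V (snd p) (\<xi> p))) (D (\<Phi> (B r q) (V (snd q) (\<xi> q)))))"
      if "p \<in> I" "q \<in> I" for p q
    proof -
      have pq: "snd p < n" "snd q < n" using that by (auto simp: I)
      show ?thesis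
        unfolding compression_ip[OF pq, symmetric] \<theta>[OF pq] \<Phi>_sum
          bounded_op_sum[OF commutant_bounded[OF D]] bounded_op_sum[OF W_bounded[OF pq(1)]] H.ip_sum_right ..
    qed
    have "s = (\<Sum>p\<in>I. \<Sum>q\<in>I. \<Sum>r\<in>I. ipK (\<Phi> (B r p) (V (snd p) (\<xi> p))) (D (\<Phi> (B r q) (V (snd q) (\<xi> q)))))"
      unfolding s by (intro sum.cong refl) (auto simp: split_def summand intro!: sum.cong)
    also have "\<dots> = (\<Sum>p\<in>I. \<Sum>r\<in>I. \<Sum>q\<in>I. ipK (\<Phi> (B r p) (V (snd p) (\<xi> p))) (D (\<Phi> (B r q) (V (snd q) (\<xi> q)))))"
      by (intro sum.cong refl sum.swap)
    also have "\<dots> = (\<Sum>r\<in>I. \<Sum>p\<in>I. \<Sum>q\<in>I. ipK (\<Phi> (B r p) (V (snd p) (\<xi> p))) (D (\<Phi> (B r q) (V (snd q) (\<xi> q)))))"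
      by (rule sum.swap)
    also have "\<dots> = (\<Sum>r\<in>I. ipK (w r) (D (w r)))"
      by (simp only: w_def K.ip_sum_left)
        (simp only: K.ip_sum_right bounded_op_sum[OF commutant_bounded[OF D]])
    finally show ?thesis
      using pos by (simp add: pos_op_def sum_nonneg)
  qed
  ultimately show ?thesis
    unfolding cn_positive_def Let_def prod.case by blast
qed

text \<open>D may be any element of the commutant, so the equivalence applies to differences T2 -
  T1.\<close>

lemma cn_positive_iff_pos_op: "cn_positive sc st \<tau> scH ipH n \<theta> \<longleftrightarrow> pos_op ipK D"
proof
  assume "cn_positive sc st \<tau> scH ipH n \<theta>"
  hence pos: "Im (gram st ipH \<theta> L L) = 0 \<and> Re (gram st ipH \<theta> L L) \<ge> 0" if "indexed n L" for L
    using cn_positive_gram[OF A.star_alg_axioms H.hilbert_axioms _ that] by blast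
  show "pos_op ipK D"
  proof (rule K.pos_op_if_dense[OF vector_of_dense commutant_bounded[OF D]])
    fix z assume "z \<in> vector_of ` Collect (indexed n)"
    then obtain L where "z = vector_of L" "indexed n L" by blast
    thus "Im (ipK z (D z)) = 0 \<and> 0 \<le> Re (ipK z (D z))"
      using pos[of L] by (simp add: gram_compression)
  qed
qed (rule cn_positive_if_pos_op)

end

section \<open>The Radon-Nikodym theorem\<close>

lemma gram_smul_left: "gram st ipH \<theta> (smul c L) M = cnj c * gram st ipH \<theta> L M"
proof (induction L)
  case Nil
  show ?case by (simp add: gram_def)
next
  case (Cons t L)
  obtain i a x where [simp]: "t = (i, a, x)" by (cases t)
  show ?case
    using Cons gram_Cons_left[of st ipH \<theta> i a x L M] gram_Cons_left[of st ipH \<theta> i a "scH c x" "smul c L" M]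
    by (simp add: distrib_left)
      (simp add: gram_def H.ip_scale_left split_def sum_list_const_mult)
qed

context
  fixes \<theta> assumes \<theta>: "cn_positive sc st \<tau> scH ipH n \<theta>"
begin

abbreviation S where "S \<equiv> gram st ipH \<theta>"

lemma \<theta>_cont_linear: "i < n \<Longrightarrow> j < n \<Longrightarrow> cont_linear_map sc \<tau> scH ipH (\<theta> i j)"
  using \<theta>[unfolded cn_positive_def, THEN conjunct1] by simp

lemma gram_smul_right:
  assumes "indexed n L" "indexed n M"
  shows "S L (smul c M) = c * S L M"
  using assms(1)
proof (induction L)
  case Nil
  show ?case by (simp add: gram_def)
next
  case (Cons t L)
  obtain i a x where [simp]: "t = (i, a, x)" by (cases t)
  have i: "i < n" using Cons.prems by simp
  have "S [(i, a, x)] (smul c M) = c * S [(i, a, x)] M"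
    using assms(2)
  proof (induction M)
    case (Cons u M)
    obtain j b y where [simp]: "u = (j, b, y)" by (cases u)
    show ?case
      using Cons bounded_opD(2)[OF cont_linear_mapD(1)[OF \<theta>_cont_linear[OF i]]]
      by (simp add: gram_def H.ip_scale_right distrib_left)
  qed (simp add: gram_def)
  thus ?case
    using Cons gram_Cons_left[of st ipH \<theta> i a x L] by (simp add: distrib_left)
qed

lemma gram_act: "S (act b L) M = S L (act (st b) M)"
  by (simp add: gram_def act_def o_def split_def A.star_mult mult.assoc)

lemma gram_self:
  assumes "indexed n L"
  shows "Im (S L L) = 0" "Re (S L L) \<ge> 0"
  using cn_positive_gram[OF A.star_alg_axioms H.hilbert_axioms \<theta> assms] by simp_all

lemma gram_expand:
  assumes "indexed n L" "indexed n M"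
  shows "S (L @ smul c M) (L @ smul c M) = S L L + c * S L M + cnj c * S M L + cnj c * c * S M M"
  using assms
  by (simp add: gram_append_left gram_append_right gram_smul_left gram_smul_right algebra_simps)

text \<open>Complete positivity does not state that theta respects adjoints. The symmetry is
  recovered by polarisation, from the reality of the form at L + c M for c = 1 and c = i.\<close>

lemma gram_hermitian:
  assumes L: "indexed n L" and M: "indexed n M"
  shows "S M L = cnj (S L M)"
proof -
  have "Im (c * S L M + cnj c * S M L) = 0" for c
    using gram_self(1)[of "L @ smul c M"] gram_self(1)[OF L] gram_self(1)[OF M] L M
    by (simp add: gram_expand mult.commute[of "cnj c" c] complex_mult_cnj)
  from this[of 1] this[of \<i>] show ?thesis by (simp add: complex_eq_iff)
qed

lemma gram_Cauchy_Schwarz: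
  assumes L: "indexed n L" and M: "indexed n M"
  shows "(cmod (S L M))\<^sup>2 \<le> Re (S L L) * Re (S M M)"
proof (rule quadratic_form_discriminant)
  fix c
  have "Re (S L L + c * S L M + cnj c * S M L + cnj c * c * S M M) \<ge> 0"
    using gram_self(2)[of "L @ smul c M"] L M by (simp add: gram_expand)
  moreover have "cnj c * c = of_real ((cmod c)\<^sup>2)"
    using complex_norm_square[of c] by (simp add: mult.commute)
  moreover have "Re (cnj c * S M L) = Re (c * S L M)"
    by (simp add: gram_hermitian[OF L M])
  ultimately show "0 \<le> Re (S L L) + 2 * Re (c * S L M) + (cmod c)\<^sup>2 * Re (S M M)"
    by simp
qed (rule gram_self(2)[OF M])

context
  assumes le: "cn_le sc st \<tau> scH ipH n \<theta> \<rho>"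
begin

text \<open>\<open>\<rho>\<close> is the compression of the identity of K, so its Gram form is the
  inner product of K; subtracting S leaves the Gram form of \<open>\<rho> - \<theta>\<close>, which
  is positive.\<close>

lemma gram_le:
  assumes L: "indexed n L"
  shows "Re (S L L) \<le> (K.nrm (vector_of L))\<^sup>2"
proof -
  have "gram st ipH (\<lambda>i j a x. \<rho> i j a x - \<theta> i j a x) L M = gram st ipH \<rho> L M - S L M" for L M
    by (simp add: gram_def H.ip_diff_right split_def sum_list_subtractf)
  moreover have "gram st ipH \<rho> L L = ipK (vector_of L) (vector_of L)"
    using gram_compression[OF commutant_id _ L L, of \<rho>] by (simp add: \<rho>_eq)
  ultimately have "Re (ipK (vector_of L) (vector_of L) - S L L) \<ge> 0"
    using cn_positive_gram[OF A.star_alg_axioms H.hilbert_axioms le[unfolded cn_le_def] L] by simp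
  thus ?thesis by (simp add: K.nrm_sq)
qed

lemma gram_bound:
  assumes L: "indexed n L" and M: "indexed n M"
  shows "cmod (S L M) \<le> K.nrm (vector_of L) * K.nrm (vector_of M)"
proof (rule power2_le_imp_le)
  have "(cmod (S L M))\<^sup>2 \<le> Re (S L L) * Re (S M M)"
    by (rule gram_Cauchy_Schwarz[OF L M])
  also have "\<dots> \<le> (K.nrm (vector_of L))\<^sup>2 * (K.nrm (vector_of M))\<^sup>2"
    by (intro mult_mono gram_le gram_self L M) simp
  finally show "(cmod (S L M))\<^sup>2 \<le> (K.nrm (vector_of L) * K.nrm (vector_of M))\<^sup>2"
    by (simp add: power_mult_distrib)
qed simp

lemma vector_of_ext:
  assumes "\<And>L. indexed n L \<Longrightarrow> ipK x (vector_of L) = ipK y (vector_of L)"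
  shows "x = y"
  by (rule K.ip_ext_dense[OF vector_of_dense]) (use assms in blast)

text \<open>f is a function of lists, not of vectors. The bound forces equal values on lists with
  the same vector, so the relation G is a bounded functional on the span.\<close>

lemma Riesz_on_vector_of:
  assumes add: "\<And>L M. indexed n L \<Longrightarrow> indexed n M \<Longrightarrow> f (L @ M) = f L + f M"
    and smul: "\<And>c L. indexed n L \<Longrightarrow> f (smul c L) = c * f L"
    and bound: "\<And>L. indexed n L \<Longrightarrow> cmod (f L) \<le> C * K.nrm (vector_of L)" and C: "C \<ge> 0"
  shows "\<exists>y. K.nrm y \<le> C \<and> (\<forall>L. indexed n L \<longrightarrow> f L = ipK y (vector_of L))"
proof -
  define G where "G = {(vector_of L, f L) | L. indexed n L}"
  have G: "(vector_of L, f L) \<in> G" if "indexed n L" for L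
    using that by (auto simp: G_def)
  have "\<exists>y. \<forall>(z, c)\<in>G. c = ipK y z"
  proof (rule K.Riesz_on_subspace)
    have "f [] = 0" using add[of "[]" "[]"] by simp
    thus "(0, 0) \<in> G" using G[of "[]"] by simp
  next
    fix z c w d assume "(z, c) \<in> G" "(w, d) \<in> G"
    then obtain L M where "indexed n L" "indexed n M" "z = vector_of L" "c = f L" "w = vector_of M" "d = f M"
      by (auto simp: G_def)
    thus "(z + w, c + d) \<in> G" using G[of "L @ M"] by (simp add: add)
  next
    fix z c a assume "(z, c) \<in> G"
    then obtain L where "indexed n L" "z = vector_of L" "c = f L" by (auto simp: G_def)
    thus "(scK a z, a * c) \<in> G" using G[of "smul a L"] by (simp add: smul vector_of_smul)
  next
    fix z c assume "(z, c) \<in> G"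
    thus "cmod c \<le> C * K.nrm z" using bound by (auto simp: G_def)
  qed
  then obtain y where y: "\<And>L. indexed n L \<Longrightarrow> f L = ipK y (vector_of L)" using G by fast
  have "K.nrm y \<le> C"
    by (rule K.nrm_le_if_dense[OF vector_of_dense C]) (use y bound in \<open>auto simp flip: y\<close>)
  thus ?thesis using y by blast
qed

text \<open>Riesz for fixed L gives y L; Riesz for the functional sending M to <x, y M> gives T x
  for every x, with |T x| <= |x|. On represented vectors the second step yields the conjugate of S M
  L, and hermitian symmetry turns it into S L M.\<close>

lemma gram_operator:
  "\<exists>T. bounded_op scK ipK scK ipK T \<and>
    (\<forall>L M. indexed n L \<longrightarrow> indexed n M \<longrightarrow> ipK (T (vector_of L)) (vector_of M) = S L M)"
proof -
  have "\<exists>y. K.nrm y \<le> K.nrm (vector_of L) \<and> (\<forall>M. indexed n M \<longrightarrow> S L M = ipK y (vector_of M))"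
    if L: "indexed n L" for L
    by (rule Riesz_on_vector_of) (simp_all add: gram_append_right gram_smul_right L gram_bound)
  then obtain y where y_nrm: "\<And>L. indexed n L \<Longrightarrow> K.nrm (y L) \<le> K.nrm (vector_of L)"
    and y: "\<And>L M. indexed n L \<Longrightarrow> indexed n M \<Longrightarrow> S L M = ipK (y L) (vector_of M)"
    by metis
  have y_add: "y (L @ M) = y L + y M" if "indexed n L" "indexed n M" for L M
    by (rule vector_of_ext) (simp add: that K.ip_add_left gram_append_left flip: y)
  have y_smul: "y (smul c L) = scK c (y L)" if "indexed n L" for c L
    by (rule vector_of_ext) (simp add: that K.ip_scale_left gram_smul_left flip: y)
  have "\<exists>t. K.nrm t \<le> K.nrm x \<and> (\<forall>M. indexed n M \<longrightarrow> ipK x (y M) = ipK t (vector_of M))" for x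
  proof (rule Riesz_on_vector_of)
    fix L :: "(nat \<times> 'a \<times> 'h) list" assume L: "indexed n L"
    have "cmod (ipK x (y L)) \<le> K.nrm x * K.nrm (y L)" by (rule K.Cauchy_Schwarz)
    also have "\<dots> \<le> K.nrm x * K.nrm (vector_of L)" by (intro mult_left_mono y_nrm L) simp
    finally show "cmod (ipK x (y L)) \<le> K.nrm x * K.nrm (vector_of L)" .
  qed (simp_all add: y_add y_smul K.ip_add_right K.ip_scale_right)
  then obtain T where T_nrm: "\<And>x. K.nrm (T x) \<le> K.nrm x"
    and T: "\<And>x M. indexed n M \<Longrightarrow> ipK x (y M) = ipK (T x) (vector_of M)"
    by metis
  have "T (x + z) = T x + T z" for x z
    by (rule vector_of_ext) (simp add: K.ip_add_left flip: T)
  moreover have "T (scK c x) = scK c (T x)" for c x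
    by (rule vector_of_ext) (simp add: K.ip_scale_left flip: T)
  ultimately have "bounded_op scK ipK scK ipK T"
    using T_nrm by (auto simp: bounded_op_def intro!: exI[of _ 1])
  moreover have "ipK (T (vector_of L)) (vector_of M) = S L M" if "indexed n L" "indexed n M" for L M
  proof -
    have "ipK (T (vector_of L)) (vector_of M) = ipK (vector_of L) (y M)" by (rule T[symmetric, OF that(2)])
    also have "\<dots> = cnj (ipK (y M) (vector_of L))" by (rule K.ip_cnj)
    also have "\<dots> = cnj (S M L)" using that by (simp add: y)
    also have "\<dots> = S L M" by (rule gram_hermitian[OF that(2,1), symmetric])
    finally show ?thesis .
  qed
  ultimately show ?thesis by blast
qed

lemma Radon_Nikodym:
  obtains T where "T \<in> unit_interval_comm scK ipK \<Phi>"
    "\<And>i j a x. i < n \<Longrightarrow> j < n \<Longrightarrow> \<theta> i j a x = W i (T (\<Phi> a (V j x)))"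
proof -
  obtain T where T_bounded: "bounded_op scK ipK scK ipK T"
    and T: "\<And>L M. indexed n L \<Longrightarrow> indexed n M \<Longrightarrow> ipK (T (vector_of L)) (vector_of M) = S L M"
    using gram_operator by blast
  have T': "ipK (vector_of L) (T (vector_of M)) = S L M" if "indexed n L" "indexed n M" for L M
    using K.ip_cnj[of "vector_of L" "T (vector_of M)"] that by (simp add: T gram_hermitian[of M L])
  have pos: "pos_op ipK T"
  proof (rule K.pos_op_if_dense[OF vector_of_dense T_bounded])
    fix z assume "z \<in> vector_of ` Collect (indexed n)"
    thus "Im (ipK z (T z)) = 0 \<and> Re (ipK z (T z)) \<ge> 0" by (auto simp: T' gram_self)
  qed
  have id_bounded: "bounded_op scK ipK scK ipK (\<lambda>x. id x - T x)"
    by (rule bounded_op_minus[OF commutant_bounded[OF commutant_id] T_bounded K.hilbert_axioms])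
  have "pos_op ipK (\<lambda>x. id x - T x)"
  proof (rule K.pos_op_if_dense[OF vector_of_dense id_bounded])
    fix z assume "z \<in> vector_of ` Collect (indexed n)"
    thus "Im (ipK z (id z - T z)) = 0 \<and> Re (ipK z (id z - T z)) \<ge> 0"
      using gram_le by (auto simp: K.ip_diff_right T' gram_self(1) K.ip_self_Im simp flip: K.nrm_sq)
  qed
  moreover have "(\<lambda>x. T (\<Phi> a x)) = (\<lambda>x. \<Phi> a (T x))" for a
  proof (rule K.bounded_op_eq_if_dense[OF vector_of_dense])
    show "bounded_op scK ipK scK ipK (\<lambda>x. T (\<Phi> a x))"
      by (rule bounded_op_comp[OF T_bounded \<Phi>_bounded K.hilbert_axioms])
    show "bounded_op scK ipK scK ipK (\<lambda>x. \<Phi> a (T x))"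
      by (rule bounded_op_comp[OF \<Phi>_bounded T_bounded K.hilbert_axioms])
  next
    fix z assume "z \<in> vector_of ` Collect (indexed n)"
    then obtain L where L: "z = vector_of L" "indexed n L" by blast
    show "T (\<Phi> a z) = \<Phi> a (T z)"
    proof (rule vector_of_ext)
      fix M :: "(nat \<times> 'a \<times> 'h) list" assume M: "indexed n M"
      have "ipK (T (\<Phi> a z)) (vector_of M) = S (act a L) M"
        using L M by (simp add: T flip: vector_of_act)
      also have "\<dots> = S L (act (st a) M)" by (rule gram_act)
      also have "\<dots> = ipK (T z) (\<Phi> (st a) (vector_of M))"
        using L M by (simp add: T flip: vector_of_act)
      also have "\<dots> = ipK (\<Phi> a (T z)) (vector_of M)" by (simp add: \<Phi>_ip)
      finally show "ipK (T (\<Phi> a z)) (vector_of M) = ipK (\<Phi> a (T z)) (vector_of M)" .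
    qed
  qed
  hence comm: "T \<in> commutant scK ipK \<Phi>"
    using T_bounded by (auto simp: commutant_def fun_eq_iff)
  ultimately have "T \<in> unit_interval_comm scK ipK \<Phi>"
    using pos by (simp add: unit_interval_comm_def op_le_def)
  moreover have "\<theta> i j a x = W i (T (\<Phi> a (V j x)))" if i: "i < n" and j: "j < n" for i j a x
  proof -
    define g where "g = (\<lambda>a x. \<theta> i j a x - W i (T (\<Phi> a (V j x))))"
    have "cont_linear_map sc \<tau> scH ipH g"
      unfolding g_def
      by (rule cont_linear_map_diff[OF H.hilbert_axioms \<theta>_cont_linear[OF i j]
            cont_linear_compression[OF T_bounded i j]])
    moreover have "g (a * b) x = 0" for a b x
    proof -
      have "\<theta> i j (a * b) x = W i (T (\<Phi> (a * b) (V j x)))"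
      proof (rule H.ip_ext[symmetric])
        fix y
        \<comment> \<open>\<open>gram\<close> stars its left entry, so \<open>st a\<close> there
          produces the product a * b.\<close>
        have "ipH y (\<theta> i j (a * b) x) = S [(i, st a, y)] [(j, b, x)]"
          by (simp add: gram_def)
        also have "\<dots> = ipK (\<Phi> (st a) (V i y)) (T (\<Phi> b (V j x)))"
          using T'[of "[(i, st a, y)]" "[(j, b, x)]"] i j by simp
        also have "\<dots> = ipH y (W i (T (\<Phi> (a * b) (V j x))))"
          by (simp add: \<Phi>_ip V_ip[OF i] \<Phi>_mult commutant_commute[OF comm])
        finally have "ipH y (\<theta> i j (a * b) x) = ipH y (W i (T (\<Phi> (a * b) (V j x))))" .
        thus "ipH (W i (T (\<Phi> (a * b) (V j x)))) y = ipH (\<theta> i j (a * b) x) y"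
          using H.ip_cnj[of "\<theta> i j (a * b) x" y] H.ip_cnj[of "W i (T (\<Phi> (a * b) (V j x)))" y] by simp
      qed
      thus ?thesis by (simp add: g_def)
    qed
    ultimately have "g a x = 0"
      by (rule cont_linear_map_zero_if_zero_on_products[OF algebra H.hilbert_axioms])
    thus ?thesis by (simp add: g_def)
  qed
  ultimately show ?thesis using that by blast
qed

end

end

section \<open>Order, bijectivity and affinity of \<open>rho_T\<close>\<close>

lemma rho_T_apply:
  assumes "i < n" "j < n"
  shows "rho_T n ipH ipK \<Phi> V T i j a x = W i (T (\<Phi> a (V j x)))"
  using assms by (simp add: rho_T_def)

lemma unit_interval_commD:
  assumes "T \<in> unit_interval_comm scK ipK \<Phi>"
  shows "T \<in> commutant scK ipK \<Phi>" "pos_op ipK T" "pos_op ipK (\<lambda>x. id x - T x)"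
  using assms by (simp_all add: unit_interval_comm_def op_le_def)

text \<open>Inside the index range the difference of the two matrices is the compression of T2 - T1,
  again an element of the commutant.\<close>

lemma rho_T_le_iff:
  assumes "T1 \<in> commutant scK ipK \<Phi>" "T2 \<in> commutant scK ipK \<Phi>"
  shows "cn_le sc st \<tau> scH ipH n (rho_T n ipH ipK \<Phi> V T1) (rho_T n ipH ipK \<Phi> V T2)
    \<longleftrightarrow> op_le ipK T1 T2"
  unfolding cn_le_def op_le_def
  by (rule cn_positive_iff_pos_op[OF commutant_diff[OF assms]])
    (simp add: rho_T_apply bounded_op_diff[OF W_bounded])

lemma rho_T_in_cp_interval:
  assumes T: "T \<in> unit_interval_comm scK ipK \<Phi>"
  shows "rho_T n ipH ipK \<Phi> V T \<in> cp_interval sc st \<tau> scH ipH n \<rho>"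
proof -
  note T = unit_interval_commD[OF T]
  have "cn_positive sc st \<tau> scH ipH n (rho_T n ipH ipK \<Phi> V T)"
    by (rule cn_positive_if_pos_op[OF T(1) _ T(2)]) (simp add: rho_T_apply)
  moreover have "cn_le sc st \<tau> scH ipH n (rho_T n ipH ipK \<Phi> V T) \<rho>"
    unfolding cn_le_def
    by (rule cn_positive_if_pos_op[OF commutant_diff[OF T(1) commutant_id] _ T(3)])
      (simp add: rho_T_apply \<rho>_eq bounded_op_diff[OF W_bounded])
  ultimately show ?thesis
    by (simp add: cp_interval_def nmat_ext_def) (auto simp: rho_T_def)
qed

lemma rho_T_inj:
  assumes T1: "T1 \<in> commutant scK ipK \<Phi>" and T2: "T2 \<in> commutant scK ipK \<Phi>"
    and eq: "rho_T n ipH ipK \<Phi> V T1 = rho_T n ipH ipK \<Phi> V T2"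
  shows "T1 = T2"
proof
  fix x
  let ?D = "\<lambda>x. T2 x - T1 x"
  \<comment> \<open>Reflexivity of \<open>cn_le\<close> on compressions, read off from reflexivity
    of \<open>op_le\<close>. Rewriting one side by \<open>eq\<close> gives both inequalities between
    T1 and T2.\<close>
  have zero: "cn_le sc st \<tau> scH ipH n (rho_T n ipH ipK \<Phi> V T) (rho_T n ipH ipK \<Phi> V T)"
    if "T \<in> commutant scK ipK \<Phi>" for T
    by (subst rho_T_le_iff[OF that that]) (simp add: op_le_def pos_op_def)
  have "op_le ipK T1 T2" "op_le ipK T2 T1"
    using zero[OF T1] zero[OF T2] eq rho_T_le_iff[OF T1 T2] rho_T_le_iff[OF T2 T1] by simp_all
  hence "ipK z (?D z) = 0" for z
    unfolding op_le_def pos_op_def K.ip_diff_right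
    by (auto simp: complex_eq_iff intro!: antisym dest!: spec[of _ z])
  moreover have "bounded_op scK ipK scK ipK ?D"
    by (rule commutant_bounded[OF commutant_diff[OF T1 T2]])
  ultimately have "?D x = 0" by (intro K.zero_if_zero_form)
  thus "T1 x = T2 x" by simp
qed

lemma bij_betw_rho_T:
  "bij_betw (rho_T n ipH ipK \<Phi> V) (unit_interval_comm scK ipK \<Phi>) (cp_interval sc st \<tau> scH ipH n \<rho>)"
proof (rule bij_betw_imageI)
  show "inj_on (rho_T n ipH ipK \<Phi> V) (unit_interval_comm scK ipK \<Phi>)"
    by (intro inj_onI rho_T_inj unit_interval_commD)
  show "rho_T n ipH ipK \<Phi> V ` unit_interval_comm scK ipK \<Phi> = cp_interval sc st \<tau> scH ipH n \<rho>"
  proof (intro equalityI subsetI)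
    fix \<theta> assume "\<theta> \<in> cp_interval sc st \<tau> scH ipH n \<rho>"
    hence ext: "nmat_ext n \<theta>" and \<theta>: "cn_positive sc st \<tau> scH ipH n \<theta>"
      and le: "cn_le sc st \<tau> scH ipH n \<theta> \<rho>"
      by (simp_all add: cp_interval_def)
    obtain T where T: "T \<in> unit_interval_comm scK ipK \<Phi>"
      "\<And>i j a x. i < n \<Longrightarrow> j < n \<Longrightarrow> \<theta> i j a x = W i (T (\<Phi> a (V j x)))"
      using Radon_Nikodym[OF \<theta> le] by blast
    \<comment> \<open>Radon-Nikodym determines only the entries with i, j < n; outside, both
      matrices are \<open>undefined\<close> by the extensional convention.\<close>
    have "\<theta> i j = rho_T n ipH ipK \<Phi> V T i j" for i j
    proof (cases "i < n \<and> j < n")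
      case True
      thus ?thesis using T(2) by (simp add: fun_eq_iff rho_T_apply)
    next
      case False
      thus ?thesis using ext by (auto simp: nmat_ext_def rho_T_def)
    qed
    hence "\<theta> = rho_T n ipH ipK \<Phi> V T" by (simp add: fun_eq_iff)
    thus "\<theta> \<in> rho_T n ipH ipK \<Phi> V ` unit_interval_comm scK ipK \<Phi>" using T(1) by blast
  qed (auto simp: rho_T_in_cp_interval)
qed

text \<open>Linearity of each \<open>W i\<close> gives this for arbitrary complex coefficients;
  convex combinations are the case s = t', t = 1 - t' with t' real in [0, 1].\<close>

lemma rho_T_affine:
  "rho_T n ipH ipK \<Phi> V (\<lambda>x. scK s (T1 x) + scK t (T2 x)) =
    (\<lambda>i j. if i < n \<and> j < n then
      (\<lambda>a x. scH s (rho_T n ipH ipK \<Phi> V T1 i j a x) + scH t (rho_T n ipH ipK \<Phi> V T2 i j a x))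
     else undefined)"
  by (auto simp: fun_eq_iff rho_T_def bounded_opD[OF W_bounded])

end

theorem theorem3p5:
  fixes sc :: "complex \<Rightarrow> 'a::ring \<Rightarrow> 'a" and st :: "'a \<Rightarrow> 'a" and \<tau> :: "'a topology"
    and scH :: "complex \<Rightarrow> 'h::ab_group_add \<Rightarrow> 'h" and ipH :: "'h \<Rightarrow> 'h \<Rightarrow> complex"
    and scK :: "complex \<Rightarrow> 'k::ab_group_add \<Rightarrow> 'k" and ipK :: "'k \<Rightarrow> 'k \<Rightarrow> complex"
    and n :: nat and \<rho> :: "nat \<Rightarrow> nat \<Rightarrow> 'a \<Rightarrow> 'h \<Rightarrow> 'h"
    and \<Phi> :: "'a \<Rightarrow> 'k \<Rightarrow> 'k" and V :: "nat \<Rightarrow> 'h \<Rightarrow> 'k"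
  assumes A: "pro_C_star_algebra sc st \<tau>"
    and H: "hilbert_space scH ipH"
    and rho: "cn_positive sc st \<tau> scH ipH n \<rho>"
    and stine: "stinespring_rep sc st \<tau> scH ipH n \<rho> scK ipK \<Phi> V"
  shows "bij_betw (rho_T n ipH ipK \<Phi> V) (unit_interval_comm scK ipK \<Phi>)
           (cp_interval sc st \<tau> scH ipH n \<rho>) \<and>
         (\<forall>T1\<in>unit_interval_comm scK ipK \<Phi>. \<forall>T2\<in>unit_interval_comm scK ipK \<Phi>.
           \<forall>t::real. 0 \<le> t \<and> t \<le> 1 \<longrightarrow>
             rho_T n ipH ipK \<Phi> V (\<lambda>x. scK (complex_of_real t) (T1 x) + scK (complex_of_real (1 - t)) (T2 x))
             = (\<lambda>i j. if i < n \<and> j < n then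
                  (\<lambda>a x. scH (complex_of_real t) (rho_T n ipH ipK \<Phi> V T1 i j a x)
                        + scH (complex_of_real (1 - t)) (rho_T n ipH ipK \<Phi> V T2 i j a x))
                else undefined)) \<and>
         (\<forall>T1\<in>unit_interval_comm scK ipK \<Phi>. \<forall>T2\<in>unit_interval_comm scK ipK \<Phi>.
           op_le ipK T1 T2 \<longleftrightarrow>
           cn_le sc st \<tau> scH ipH n (rho_T n ipH ipK \<Phi> V T1) (rho_T n ipH ipK \<Phi> V T2))"
proof -
  have "hilbert_space scK ipK"
    using stine by (simp add: stinespring_rep_def)
  moreover have "star_algebra sc st"
    using A by (simp add: pro_C_star_algebra_def)
  ultimately interpret stinespring sc st scH ipH scK ipK \<tau> n \<rho> \<Phi> V
    using A H stine by unfold_locales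
  show ?thesis
    using bij_betw_rho_T rho_T_affine rho_T_le_iff unit_interval_commD(1) by blast
qed

end
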